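(* We have $\frac{2}{t^2} \ge 3Q(t)^2$ whenever $0 < t \le 0.2$ or $t \ge 1.5$.
   Context: $Q(t)$, $t\ge 0$, denotes the radial profile of the positive radial ground state of $\Delta\phi - \phi + |\phi|^2\phi = 0$ on $\mathbb{R}^3$; it solves $-Q'' - \frac{2}{t}Q' + Q - Q^3 = 0$. *)

theory Defs
  imports "HOL-Analysis.Analysis"
begin

text \<open>Radial profile of the positive radial ground state of
  Delta phi - phi + phi^3 = 0 on R^3: a positive solution on [0,oo) of
  -Q'' - (2/t) Q' + Q - Q^3 = 0, regular at the origin (Q continuous at 0,
  Q'(0) = 0) and decaying at infinity. By Coffman's uniqueness theorem this
  determines Q uniquely.\<close>
definition ground_state_profile :: "(real \<Rightarrow> real) \<Rightarrow> bool" where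
  "ground_state_profile Q \<longleftrightarrow>
     continuous_on {0..} Q \<and>
     (\<forall>t\<ge>0. Q t > 0) \<and>
     (\<exists>Q' Q''.
        (\<forall>t>0. (Q has_real_derivative Q' t) (at t)) \<and>
        (\<forall>t>0. (Q' has_real_derivative Q'' t) (at t)) \<and>
        (\<forall>t>0. - Q'' t - (2 / t) * Q' t + Q t - (Q t)^3 = 0) \<and>
        (Q has_real_derivative 0) (at_right 0) \<and>
        (Q' \<longlongrightarrow> 0) (at_right 0)) \<and>
     (Q \<longlongrightarrow> 0) at_top"

end

theory Submission
  imports Defs
begin

text \<open>
  Put \<open>e = - t Q' / Q\<close> and \<open>q = t^2 Q^2\<close>; the claim is \<open>q \<le> 2/3\<close>. Solutions that are regular at the
  origin satisfy, for small \<open>t\<close>, a relation \<open>q \<approx> G (e, t^2)\<close>, and polynomial sub- and supersolutions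
  enclose \<open>q\<close> between two such functions. Solutions that decay at infinity satisfy a relation of
  their own: \<open>0 < 1 + t - e\<close>, sharpened to \<open>k q + l q^2 \<le> 1 + t - e\<close>, and
  \<open>v^2 > u^2 (1 - Q^2 / 2)\<close> for \<open>u = t Q\<close>, \<open>v = u'\<close>, because
  \<open>v^2 - u^2 + u^2 Q^2 / 2\<close> decreases to \<open>0\<close>.

  If \<open>q > 2/3\<close> somewhere on \<open>(0, 1/5]\<close>, then \<open>e\<close> is already so large there that the lower enclosure
  drives it to \<open>7/5\<close> at \<open>t = 7/10\<close>, which violates the decay relation. If \<open>q > 2/3\<close> at some
  \<open>t \<ge> 3/2\<close>, then the energy inequality propagates this back to \<open>q \<ge> 1.27\<close> at \<open>t = 1\<close>, and there it
  is incompatible with the upper enclosure.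
\<close>

subsection \<open>Barriers for scalar functions\<close>

text \<open>If \<open>D t\<close> were negative, \<open>D\<close> would vanish at the last point
  where it is nonnegative, and the positive derivative there would push it above zero again. So a
  differential inequality has to be checked only on the barrier itself.\<close>

lemma nonneg_after_upward_zeros:
  fixes D D' :: "real \<Rightarrow> real"
  assumes le: "s \<le> t" and start: "0 \<le> D s"
    and der: "\<And>x. s \<le> x \<Longrightarrow> x \<le> t \<Longrightarrow> (D has_real_derivative D' x) (at x)"
    and zero: "\<And>x. s \<le> x \<Longrightarrow> x \<le> t \<Longrightarrow> D x = 0 \<Longrightarrow> 0 < D' x"
  shows "0 \<le> D t"
proof (rule ccontr)
  assume "\<not> 0 \<le> D t"
  then have neg: "D t < 0" by simp
  have cont: "isCont D x" if "s \<le> x" "x \<le> t" for x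
    using der[OF that] DERIV_isCont by blast
  define S where "S = {x \<in> {s..t}. 0 \<le> D x}"
  have "closed S"
  proof -
    have "continuous_on {s..t} D"
      using cont by (auto intro: continuous_at_imp_continuous_on)
    then have "closed ({s..t} \<inter> D -` {0..})"
      by (intro continuous_closed_preimage) auto
    moreover have "{s..t} \<inter> D -` {0..} = S"
      by (auto simp: S_def)
    ultimately show ?thesis by simp
  qed
  moreover have "s \<in> S" using le start by (simp add: S_def)
  moreover have bdd: "bdd_above S" by (auto simp: S_def)
  ultimately have cS: "Sup S \<in> S"
    using closed_contains_Sup by blast
  define c where "c = Sup S"
  have c: "s \<le> c" "c \<le> t" "0 \<le> D c"
    using cS by (auto simp: S_def c_def)
  have "c \<noteq> t" using c neg by auto
  then have ct: "c < t" using c by simp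
  have after: "D x < 0" if "c < x" "x \<le> t" for x
  proof (rule ccontr)
    assume "\<not> D x < 0"
    then have "x \<in> S" using that c by (simp add: S_def)
    then have "x \<le> c" using cSup_upper[OF _ bdd] by (simp add: c_def)
    then show False using that by simp
  qed
  have Dc: "0 < D' c" if "D c = 0"
    using zero[OF c(1,2) that] .
  show False
  proof (cases "D c = 0")
    case True
    obtain d where d: "d > 0" "\<And>h. 0 < h \<Longrightarrow> h < d \<Longrightarrow> D c < D (c + h)"
      using DERIV_pos_inc_right[OF der[OF c(1,2)] Dc[OF True]] by blast
    define h where "h = min (d / 2) (t - c)"
    have "0 < h" "h < d" "h \<le> t - c" using d ct by (auto simp: h_def)
    then have "0 < D (c + h)" "D (c + h) < 0"
      using d(2)[of h] True after[of "c + h"] by auto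
    then show False by simp
  next
    case False
    then have pos: "0 < D c" using c by simp
    have "\<exists>x. c \<le> x \<and> x \<le> t \<and> D x = 0"
      using IVT2[of D t 0 c] neg pos ct cont c by force
    then obtain x where "c \<le> x" "x \<le> t" "D x = 0" by blast
    then show False using after[of x] pos by (cases "x = c") auto
  qed
qed

text \<open>The equations are singular at \<open>0\<close>, where \<open>D\<close> has only a limit
  and no starting sign. If \<open>D t < 0\<close>, the previous lemma makes \<open>D\<close>
  negative on all of \<open>(0, t]\<close>; then \<open>inc\<close> makes it increase near
  \<open>0\<close>, so its limit \<open>0\<close> would lie below a negative value.\<close>

lemma nonneg_from_origin:
  fixes D D' :: "real \<Rightarrow> real"
  assumes "0 < t"
    and der: "\<And>x. 0 < x \<Longrightarrow> x \<le> t \<Longrightarrow> (D has_real_derivative D' x) (at x)"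
    and zero: "\<And>x. 0 < x \<Longrightarrow> x \<le> t \<Longrightarrow> D x = 0 \<Longrightarrow> 0 < D' x"
    and lim: "(D \<longlongrightarrow> 0) (at_right 0)"
    and inc: "\<forall>\<^sub>F x in at_right 0. D x < 0 \<longrightarrow> 0 < D' x"
  shows "0 \<le> D t"
proof (rule ccontr)
  assume "\<not> 0 \<le> D t"
  have neg: "D x < 0" if "0 < x" "x \<le> t" for x
  proof (rule ccontr)
    assume "\<not> D x < 0"
    then have "0 \<le> D t"
      using that by (intro nonneg_after_upward_zeros[of x t D D'] der zero) auto
    then show False using \<open>\<not> 0 \<le> D t\<close> by simp
  qed
  obtain d where d: "d > 0" "\<And>x. 0 < x \<Longrightarrow> x < d \<Longrightarrow> D x < 0 \<longrightarrow> 0 < D' x"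
    using inc by (auto simp: eventually_at_right_field)
  define y where "y = min (d / 2) t"
  have y: "0 < y" "y < d" "y \<le> t" using d \<open>0 < t\<close> by (auto simp: y_def)
  have less: "D x < D y" if "0 < x" "x < y" for x
  proof (rule DERIV_pos_imp_increasing[OF that(2)])
    fix z assume z: "x \<le> z" "z \<le> y"
    show "\<exists>l. (D has_real_derivative l) (at z) \<and> 0 < l"
      using der[of z] d(2)[of z] neg[of z] z y that by auto
  qed
  have "0 \<le> D y"
  proof (rule tendsto_upperbound[OF lim])
    show "\<forall>\<^sub>F x in at_right 0. D x \<le> D y"
      using less y(1) by (force simp: eventually_at_right_field)
  qed simp
  then show False using neg[OF y(1,3)] by simp
qed

lemma pos_if_decreasing_to_0:
  fixes f f' :: "real \<Rightarrow> real"
  assumes "0 < t" and der: "\<And>x. 0 < x \<Longrightarrow> (f has_real_derivative f' x) (at x)"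
    and neg: "\<And>x. 0 < x \<Longrightarrow> f' x < 0" and lim: "(f \<longlongrightarrow> 0) at_top"
  shows "0 < f t"
proof -
  have dec: "f y < f x" if "0 < x" "x < y" for x y
  proof (rule DERIV_neg_imp_decreasing[OF that(2)])
    fix z assume "x \<le> z" "z \<le> y"
    then have "0 < z" using that by simp
    then show "\<exists>l. (f has_real_derivative l) (at z) \<and> l < 0"
      using der neg by blast
  qed
  have "0 \<le> f (t + 1)"
  proof (rule tendsto_upperbound[OF lim])
    show "\<forall>\<^sub>F x in at_top. f x \<le> f (t + 1)"
      using eventually_gt_at_top[of "t + 1"]
      by eventually_elim (use dec \<open>0 < t\<close> in \<open>auto intro: less_imp_le\<close>)
  qed simp
  also have "\<dots> < f t" using dec[of t "t + 1"] \<open>0 < t\<close> by simp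
  finally show ?thesis .
qed

text \<open>For use where \<open>Q'\<close> vanishes and the energy reduces to its potential part:
  nonnegativity forces \<open>x^2 >= 2\<close>, and \<open>1 < x\<close> is what fixes the sign of
  \<open>Q - Q^3\<close>.\<close>

lemma critical_energy:
  fixes x :: real
  assumes "0 < x" "0 \<le> x ^ 4 / 4 - x\<^sup>2 / 2"
  shows "1 < x"
proof -
  have "x ^ 4 / 4 - x\<^sup>2 / 2 = x\<^sup>2 / 4 * (x\<^sup>2 - 2)" by algebra
  then have "0 \<le> x\<^sup>2 / 4 * (x\<^sup>2 - 2)" using assms(2) by linarith
  then have "0 \<le> x\<^sup>2 - 2" using assms(1) by (simp add: zero_le_mult_iff)
  then have "1\<^sup>2 < x\<^sup>2" by simp
  then show ?thesis using assms(1) by (intro power2_less_imp_less[of 1 x]) auto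
qed

subsection \<open>Polynomial enclosures\<close>

text \<open>
  The certificates \<open>eq\<close> below are expansions in the Bernstein basis of the interval in question,
  so that every summand is visibly nonnegative.
\<close>

lemma ge_by_certificate:
  fixes c d p s :: real
  assumes "c * (p - d) = s" "0 \<le> s" "0 < c"
  shows "d \<le> p"
  using assms by (metis diff_ge_0_iff_ge zero_le_mult_iff not_less)

text \<open>
  Both polynomials are perturbations of the Taylor expansion
  \<open>q = 3 e + \<tau> - (9/5) e^2 - (2/5) \<tau> e + ...\<close> of the surface swept out in the variables
  \<open>e\<close>, \<open>\<tau> = t^2\<close>, \<open>q\<close> by the solutions that are regular at the origin; the
  coefficients were found by numerical search so that the residuals below have a sign.
\<close>

definition upper_poly :: "real \<Rightarrow> real \<Rightarrow> real" where
  "upper_poly e \<tau> = 3*e + \<tau> - 17/10*e^2 - 2/25*e^3 + 7/40*e^4 - 2/5*\<tau>*e - 7/50*\<tau>*e^2"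

definition lower_poly :: "real \<Rightarrow> real \<Rightarrow> real" where
  "lower_poly e \<tau> = 3*e + \<tau> - 9/5*e^2 + 9/100*e^3 + 3/40*e^4 - 16/25*\<tau>*e"

section \<open>Signs of the residuals of the two polynomials\<close>

text \<open>The polynomial is the residual of \<open>lower_poly\<close> at \<open>\<tau> = 0\<close>
  divided by \<open>e^3\<close>; its companion below is the residual at
  \<open>\<tau> = 49/100\<close> divided by \<open>e\<close>. The margin \<open>1/1000\<close>
  yields strict positivity from certificates that are merely nonnegative.\<close>

lemma lower_residual_at_0:
  fixes e :: real
  assumes "0 \<le> e" "e \<le> 17/10"
  shows "1/1000 \<le> (9/100) - (63/200)*e + (3357/10000)*e^2 - (189/4000)*e^3 - (9/400)*e^4"
proof -
  \<comment> \<open>The range is subdivided so that on every piece all Bernstein coefficients are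
    nonnegative.\<close>
  consider "e \<le> 1/2" | "1/2 \<le> e" "e \<le> 1" | "1 \<le> e" by linarith
  then show ?thesis
  proof cases
    case 1
    have eq: "20000 * ((9/100) - (63/200)*e + (3357/10000)*e^2 - (189/4000)*e^3 - (9/400)*e^4 - 1/1000) =
        1780*(1 - 2*e)^4 +
        7940*e*(1 - 2*e)^3 +
        11634*e^2*(1 - 2*e)^2 +
        7271*e^3*(1 - 2*e) +
        2596*e^4"
      by algebra
    show ?thesis
      using assms 1 by (intro ge_by_certificate[OF eq] add_nonneg_nonneg mult_nonneg_nonneg zero_le_power) simp_all
  next
    case 2
    have eq: "20000 * ((9/100) - (63/200)*e + (3357/10000)*e^2 - (189/4000)*e^3 - (9/400)*e^4 - 1/1000) =
        2596*(1 - e)^4 +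
        3113*(2*e - 1)*(1 - e)^3 +
        5397*(2*e - 1)^2*(1 - e)^2 +
        3899*(2*e - 1)^3*(1 - e) +
        799*(2*e - 1)^4"
      by algebra
    show ?thesis
      using assms 2 by (intro ge_by_certificate[OF eq] add_nonneg_nonneg mult_nonneg_nonneg zero_le_power) simp_all
  next
    case 3
    have eq: "48020000 * ((9/100) - (63/200)*e + (3357/10000)*e^2 - (189/4000)*e^3 - (9/400)*e^4 - 1/1000) =
        799*(17 - 10*e)^4 +
        49411*(e - 1)*(17 - 10*e)^3 +
        1060701*(e - 1)^2*(17 - 10*e)^2 +
        8645185*(e - 1)^3*(17 - 10*e) +
        20722300*(e - 1)^4"
      by algebra
    show ?thesis
      using assms 3 by (intro ge_by_certificate[OF eq] add_nonneg_nonneg mult_nonneg_nonneg zero_le_power) simp_all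
  qed
qed

lemma lower_residual_at_end:
  fixes e :: real
  assumes "0 \<le> e" "e \<le> 17/10"
  shows "1/1000 \<le> (382543/781250) - (2352/3125)*e + (12681/62500)*e^2 - (987/5000)*e^3 + (3357/10000)*e^4 - (189/4000)*e^5 - (9/400)*e^6"
proof -
  consider "e \<le> 1" | "1 \<le> e" by linarith
  then show ?thesis
  proof cases
    case 1
    have eq: "12500000 * ((382543/781250) - (2352/3125)*e + (12681/62500)*e^2 - (987/5000)*e^3 + (3357/10000)*e^4 - (189/4000)*e^5 - (9/400)*e^6 - 1/1000) =
        6108188*(1 - e)^6 +
        27241128*e*(1 - e)^5 +
        47119020*e^2*(1 - e)^4 +
        35761060*e^3*(1 - e)^3 +
        9553770*e^4*(1 - e)^2 +
        153303*e^5*(1 - e) +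
        93263*e^6"
      by algebra
    show ?thesis
      using assms 1 by (intro ge_by_certificate[OF eq] add_nonneg_nonneg mult_nonneg_nonneg zero_le_power) simp_all
  next
    case 2
    have eq: "1470612500000 * ((382543/781250) - (2352/3125)*e + (12681/62500)*e^2 - (987/5000)*e^3 + (3357/10000)*e^4 - (189/4000)*e^5 - (9/400)*e^6 - 1/1000) =
        93263*(17 - 10*e)^6 +
        8439705*(e - 1)*(17 - 10*e)^5 +
        781214550*(e - 1)^2*(17 - 10*e)^4 +
        25629820750*(e - 1)^3*(17 - 10*e)^3 +
        363429016875*(e - 1)^4*(17 - 10*e)^2 +
        2300176415625*(e - 1)^5*(17 - 10*e) +
        5194156437500*(e - 1)^6"
      by algebra
    show ?thesis
      using assms 2 by (intro ge_by_certificate[OF eq] add_nonneg_nonneg mult_nonneg_nonneg zero_le_power) simp_all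
  qed
qed

text \<open>On the surface \<open>q = lower_poly e \<tau>\<close> with \<open>\<tau> = t^2\<close>,
  the expression is \<open>t\<close> times the derivative of \<open>q - lower_poly e \<tau>\<close>
  along the flow, so its sign makes the surface a barrier. The ranges are those given by
  \<open>t <= 7/10\<close> and \<open>e < 1 + t\<close>.\<close>

lemma lower_poly_residual:
  fixes e \<tau> :: real
  assumes e: "0 < e" "e \<le> 17/10" and \<tau>: "0 \<le> \<tau>" "\<tau> \<le> 49/100"
  shows "0 < 2*(1 - e)*lower_poly e \<tau>
    - (3 - 18/5*e + 27/100*e^2 + 3/10*e^3 - 16/25*\<tau>)*(lower_poly e \<tau> - \<tau> - e + e^2)
    - 2*\<tau>*(1 - 16/25*e)" (is "0 < ?R")
proof -
  let ?P = "(9/100) - (63/200)*e + (3357/10000)*e^2 - (189/4000)*e^3 - (9/400)*e^4"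
  let ?S = "(382543/781250) - (2352/3125)*e + (12681/62500)*e^2 - (987/5000)*e^3 + (3357/10000)*e^4 - (189/4000)*e^5 - (9/400)*e^6"
  \<comment> \<open>The residual divided by \<open>e\<close> is concave in \<open>\<tau>\<close>, so its values at the two ends suffice.\<close>
  have eq: "49/100 * ?R = e*((49/100 - \<tau>)*(e^2*?P) + \<tau>*?S + 49/100*(256/625)*(\<tau>*(49/100 - \<tau>)))"
    unfolding lower_poly_def by algebra
  have P: "0 < ?P" and S: "0 < ?S"
    using lower_residual_at_0[of e] lower_residual_at_end[of e] e by linarith+
  have "0 \<le> \<tau>*(49/100 - \<tau>)" using \<tau> by simp
  moreover have "0 < (49/100 - \<tau>)*(e^2*?P) + \<tau>*?S"
  proof (cases "\<tau> = 0")
    case True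
    then show ?thesis using P e by simp
  next
    case False
    then have "0 < \<tau>*?S" using S \<tau> by simp
    moreover have "0 \<le> (49/100 - \<tau>)*(e^2*?P)" using P e \<tau> by simp
    ultimately show ?thesis by linarith
  qed
  ultimately have "0 < 49/100 * ?R"
    unfolding eq using e by (intro mult_pos_pos) (simp_all add: add_pos_nonneg)
  then show ?thesis by (simp add: zero_less_mult_iff)
qed

text \<open>This polynomial and the one in the next lemma are not end values of the residual itself:
  they are the end values, divided by \<open>e^2\<close>, of the minorant of the negated residual
  that is affine in \<open>\<tau>\<close>.\<close>

lemma upper_residual_at_0:
  fixes e :: real
  assumes "0 \<le> e" "e \<le> 2"
  shows "1/1000 \<le> (1/2) - (719/450)*e + (5509/3000)*e^2 - (32407/45000)*e^3 - (49/500)*e^4 + (49/400)*e^5"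
proof -
  consider "e \<le> 1" | "1 \<le> e" by linarith
  then show ?thesis
  proof cases
    case 1
    have eq: "90000 * ((1/2) - (719/450)*e + (5509/3000)*e^2 - (32407/45000)*e^3 - (49/500)*e^4 + (49/400)*e^5 - 1/1000) =
        44910*(1 - e)^5 +
        80750*e*(1 - e)^4 +
        39170*e^2*(1 - e)^3 +
        17296*e^3*(1 - e)^2 +
        6712*e^4*(1 - e) +
        3771*e^5"
      by algebra
    show ?thesis
      using assms 1 by (intro ge_by_certificate[OF eq] add_nonneg_nonneg mult_nonneg_nonneg zero_le_power) simp_all
  next
    case 2
    have eq: "90000 * ((1/2) - (719/450)*e + (5509/3000)*e^2 - (32407/45000)*e^3 - (49/500)*e^4 + (49/400)*e^5 - 1/1000) =
        3771*(2 - e)^5 +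
        30998*(e - 1)*(2 - e)^4 +
        114440*(e - 1)^2*(2 - e)^3 +
        205198*(e - 1)^3*(2 - e)^2 +
        218518*(e - 1)^4*(2 - e) +
        111558*(e - 1)^5"
      by algebra
    show ?thesis
      using assms 2 by (intro ge_by_certificate[OF eq] add_nonneg_nonneg mult_nonneg_nonneg zero_le_power) simp_all
  qed
qed

lemma upper_residual_at_end:
  fixes e :: real
  assumes "0 \<le> e" "e \<le> 2"
  shows "1/1000 \<le> (7/15) - (2173/2250)*e + (23527/15000)*e^2 - (19511/22500)*e^3 - (49/500)*e^4 + (49/400)*e^5"
proof -
  consider "e \<le> 4/5" | "4/5 \<le> e" "e \<le> 8/5" | "8/5 \<le> e" by linarith
  then show ?thesis
  proof cases
    case 1
    have eq: "46080000 * ((7/15) - (2173/2250)*e + (23527/15000)*e^2 - (19511/22500)*e^3 - (49/500)*e^4 + (49/400)*e^5 - 1/1000) =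
        20955*(4 - 5*e)^5 +
        350035*e*(4 - 5*e)^4 +
        2891246*e^2*(4 - 5*e)^3 +
        14559782*e^3*(4 - 5*e)^2 +
        37158535*e^4*(4 - 5*e) +
        35561175*e^5"
      by algebra
    show ?thesis
      using assms 1 by (intro ge_by_certificate[OF eq] add_nonneg_nonneg mult_nonneg_nonneg zero_le_power) simp_all
  next
    case 2
    have eq: "5760000000 * ((7/15) - (2173/2250)*e + (23527/15000)*e^2 - (19511/22500)*e^3 - (49/500)*e^4 + (49/400)*e^5 - 1/1000) =
        1422447*(8 - 5*e)^5 +
        6792763*(5*e - 4)*(8 - 5*e)^4 +
        12004006*(5*e - 4)^2*(8 - 5*e)^3 +
        8337254*(5*e - 4)^3*(8 - 5*e)^2 +
        1624475*(5*e - 4)^4*(8 - 5*e) +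
        146703*(5*e - 4)^5"
      by algebra
    show ?thesis
      using assms 2 by (intro ge_by_certificate[OF eq] add_nonneg_nonneg mult_nonneg_nonneg zero_le_power) simp_all
  next
    case 3
    have eq: "1440000 * ((7/15) - (2173/2250)*e + (23527/15000)*e^2 - (19511/22500)*e^3 - (49/500)*e^4 + (49/400)*e^5 - 1/1000) =
        3667575*(2 - e)^5 +
        1440175*(5*e - 8)*(2 - e)^4 +
        511706*(5*e - 8)^2*(2 - e)^3 +
        372986*(5*e - 8)^3*(2 - e)^2 +
        109615*(5*e - 8)^4*(2 - e) +
        10023*(5*e - 8)^5"
      by algebra
    show ?thesis
      using assms 3 by (intro ge_by_certificate[OF eq] add_nonneg_nonneg mult_nonneg_nonneg zero_le_power) simp_all
  qed
qed

text \<open>The counterpart for the upper surface, with the opposite sign; \<open>t <= 1\<close> and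
  \<open>e < 1 + t\<close> give the ranges.\<close>

lemma upper_poly_residual:
  fixes e \<tau> :: real
  assumes e: "0 < e" "e \<le> 2" and \<tau>: "0 \<le> \<tau>" "\<tau> \<le> 1"
  shows "2*(1 - e)*upper_poly e \<tau>
    - (3 - 17/5*e - 6/25*e^2 + 7/10*e^3 - 2/5*\<tau> - 7/25*\<tau>*e)*(upper_poly e \<tau> - \<tau> - e + e^2)
    - 2*\<tau>*(1 - 2/5*e - 7/50*e^2) < 0" (is "?R < 0")
proof -
  let ?C = "e*((2/5 + 7/25*e)*(2/5 + 7/50*e))"
  let ?P = "(1/2) - (719/450)*e + (5509/3000)*e^2 - (32407/45000)*e^3 - (49/500)*e^4 + (49/400)*e^5"
  let ?S = "(7/15) - (2173/2250)*e + (23527/15000)*e^2 - (19511/22500)*e^3 - (49/500)*e^4 + (49/400)*e^5"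
  \<comment> \<open>Convex in \<open>\<tau>\<close>: the quadratic term is replaced by its tangent at \<open>\<tau> = e/3\<close>.\<close>
  have eq: "- ?R = e^2*((1 - \<tau>)*?P + \<tau>*?S) + ?C*(\<tau> - e/3)^2"
    unfolding upper_poly_def by algebra
  have P: "0 < ?P" and S: "0 < ?S"
    using upper_residual_at_0[of e] upper_residual_at_end[of e] e by linarith+
  have "0 < (1 - \<tau>)*?P + \<tau>*?S"
  proof (cases "\<tau> = 0")
    case True
    then show ?thesis using P by simp
  next
    case False
    then have "0 < \<tau>*?S" using S \<tau> by simp
    moreover have "0 \<le> (1 - \<tau>)*?P" using P \<tau> by simp
    ultimately show ?thesis by linarith
  qed
  then have "0 < e^2*((1 - \<tau>)*?P + \<tau>*?S)" using e by simp
  moreover have "0 \<le> ?C*(\<tau> - e/3)^2" using e by simp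
  ultimately show ?thesis using eq by linarith
qed

section \<open>Numerical inequalities for the barriers and at the times \<open>1/5\<close>,
  \<open>7/10\<close> and \<open>1\<close>\<close>

text \<open>If \<open>q\<close> is at least \<open>lower_poly\<close>, then \<open>t\<close> times
  the derivative of \<open>e\<close> is at least \<open>lower_poly e (t^2) - t^2 - e + e^2\<close>.
  Each of the four quadratics grows more slowly than that on its interval, so \<open>e\<close>
  cannot cross it downwards.\<close>

lemma barrier_slope_1:
  fixes e t :: real
  assumes "1/5 \<le> t" "t \<le> 1/4"
    and e: "e = 61/250 + 217/100*(t - 1/5) + 12/5*(t - 1/5)^2"
  shows "1/1000 \<le> lower_poly e (t^2) - t^2 - e + e^2 - t*(217/100 + 24/5*(t - 1/5))"
proof -
  have eq: "2500000000000 * (lower_poly e (t^2) - t^2 - e + e^2 - t*(217/100 + 24/5*(t - 1/5)) - 1/1000) =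
      681690143750000*(1 - 4*t)^8 +
      15657937185000000*(5*t - 1)*(1 - 4*t)^7 +
      67668901525875000*(5*t - 1)^2*(1 - 4*t)^6 +
      133432027103200000*(5*t - 1)^3*(1 - 4*t)^5 +
      145155433224021875*(5*t - 1)^4*(1 - 4*t)^4 +
      91500193349582000*(5*t - 1)^5*(1 - 4*t)^3 +
      32360928621530400*(5*t - 1)^6*(1 - 4*t)^2 +
      5560371931298560*(5*t - 1)^7*(1 - 4*t) +
      283085709660928*(5*t - 1)^8"
    unfolding lower_poly_def e by algebra
  show ?thesis
    using assms(1,2) by (intro ge_by_certificate[OF eq] add_nonneg_nonneg mult_nonneg_nonneg zero_le_power) simp_all
qed

lemma barrier_slope_2:
  fixes e t :: real
  assumes "1/4 \<le> t" "t \<le> 7/20"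
    and e: "e = 179/500 + 241/100*(t - 1/4) + 4/5*(t - 1/4)^2"
  shows "1/1000 \<le> lower_poly e (t^2) - t^2 - e + e^2 - t*(241/100 + 8/5*(t - 1/4))"
proof -
  have eq: "10240000000000000 * (lower_poly e (t^2) - t^2 - e + e^2 - t*(241/100 + 8/5*(t - 1/4)) - 1/1000) =
      40407795888*(7 - 20*t)^8 +
      12319542147040*(4*t - 1)*(7 - 20*t)^7 +
      350878932211400*(4*t - 1)^2*(7 - 20*t)^6 +
      4333838019253000*(4*t - 1)^3*(7 - 20*t)^5 +
      28907397902771875*(4*t - 1)^4*(7 - 20*t)^4 +
      109472504602487500*(4*t - 1)^5*(7 - 20*t)^3 +
      224578069530406250*(4*t - 1)^6*(7 - 20*t)^2 +
      202583036079062500*(4*t - 1)^7*(7 - 20*t) +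
      22843262344921875*(4*t - 1)^8"
    unfolding lower_poly_def e by algebra
  show ?thesis
    using assms(1,2) by (intro ge_by_certificate[OF eq] add_nonneg_nonneg mult_nonneg_nonneg zero_le_power) simp_all
qed

lemma barrier_slope_3:
  fixes e t :: real
  assumes "7/20 \<le> t" "t \<le> 1/2"
    and e: "e = 607/1000 + 64/25*(t - 7/20) - 17/25*(t - 7/20)^2"
  shows "1/1000 \<le> lower_poly e (t^2) - t^2 - e + e^2 - t*(64/25 - 34/25*(t - 7/20))"
proof -
  have eq: "2624400000000000000000 * (lower_poly e (t^2) - t^2 - e + e^2 - t*(64/25 - 34/25*(t - 7/20)) - 1/1000) =
      198478751603000000000000*(1 - 2*t)^8 +
      460896219176800000000000*(20*t - 7)*(1 - 2*t)^7 +
      230899279492292000000000*(20*t - 7)^2*(1 - 2*t)^6 +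
      53523452283378400000000*(20*t - 7)^3*(1 - 2*t)^5 +
      6868447969873778000000*(20*t - 7)^4*(1 - 2*t)^4 +
      510956274283098400000*(20*t - 7)^5*(1 - 2*t)^3 +
      21296991011759492000*(20*t - 7)^6*(1 - 2*t)^2 +
      429240297856496800*(20*t - 7)^7*(1 - 2*t) +
      2505676350861203*(20*t - 7)^8"
    unfolding lower_poly_def e by algebra
  show ?thesis
    using assms(1,2) by (intro ge_by_certificate[OF eq] add_nonneg_nonneg mult_nonneg_nonneg zero_le_power) simp_all
qed

lemma barrier_slope_4:
  fixes e t :: real
  assumes "1/2 \<le> t" "t \<le> 7/10"
    and e: "e = 39/40 + 59/25*(t - 1/2) - 117/100*(t - 1/2)^2"
  shows "1/1000 \<le> lower_poly e (t^2) - t^2 - e + e^2 - t*(59/25 - 117/50*(t - 1/2))"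
proof -
  have eq: "16384000000000 * (lower_poly e (t^2) - t^2 - e + e^2 - t*(59/25 - 117/50*(t - 1/2)) - 1/1000) =
      236411875*(7 - 10*t)^8 +
      16416775000*(2*t - 1)*(7 - 10*t)^7 +
      322408097100*(2*t - 1)^2*(7 - 10*t)^6 +
      3019861367480*(2*t - 1)^3*(7 - 10*t)^5 +
      15782576725538*(2*t - 1)^4*(7 - 10*t)^4 +
      48903543381736*(2*t - 1)^5*(7 - 10*t)^3 +
      92518475201772*(2*t - 1)^6*(7 - 10*t)^2 +
      108892492368264*(2*t - 1)^7*(7 - 10*t) +
      69994460102003*(2*t - 1)^8"
    unfolding lower_poly_def e by algebra
  show ?thesis
    using assms(1,2) by (intro ge_by_certificate[OF eq] add_nonneg_nonneg mult_nonneg_nonneg zero_le_power) simp_all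
qed

text \<open>This fixes the threshold \<open>61/250\<close>: a smaller \<open>e\<close> at
  \<open>t = 1/5\<close> is incompatible with \<open>q > 2/3\<close>. The minus signs fit the shape
  of \<open>ge_by_certificate\<close>.\<close>

lemma upper_poly_small:
  fixes e :: real
  assumes "0 \<le> e" "e \<le> 61/250"
  shows "-2/3 \<le> - upper_poly e (1/25)"
proof -
  have eq: "207687615000 * (- upper_poly e (1/25) - (-2/3)) =
      9400*(61 - 250*e)^4 +
      6669640*e*(61 - 250*e)^3 +
      1572428064*e^2*(61 - 250*e)^2 +
      123428909200*e^3*(61 - 250*e) +
      38502967375*e^4"
    unfolding upper_poly_def by algebra
  show ?thesis
    using assms(1,2) by (intro ge_by_certificate[OF eq] add_nonneg_nonneg mult_nonneg_nonneg zero_le_power) simp_all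
qed

text \<open>Any bound below \<open>2\<close> would do: it gives \<open>Q 1 ^ 2 < 2\<close>, which
  makes the factor \<open>1 - Q^2 / 2\<close> of the energy inequality positive from
  \<open>t = 1\<close> on.\<close>

lemma upper_poly_at_1:
  fixes e :: real
  assumes "0 \<le> e" "e \<le> 2"
  shows "-199/100 \<le> - upper_poly e 1"
proof -
  consider "e \<le> 1/2" | "1/2 \<le> e" "e \<le> 1" | "1 \<le> e" by linarith
  then show ?thesis
  proof cases
    case 1
    have eq: "200 * (- upper_poly e 1 - (-199/100)) =
        198*(1 - 2*e)^4 +
        1064*e*(1 - 2*e)^3 +
        2000*e^2*(1 - 2*e)^2 +
        1584*e^3*(1 - 2*e) +
        477*e^4"
      unfolding upper_poly_def by algebra
    show ?thesis
      using assms 1 by (intro ge_by_certificate[OF eq] add_nonneg_nonneg mult_nonneg_nonneg zero_le_power) simp_all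
  next
    case 2
    have eq: "200 * (- upper_poly e 1 - (-199/100)) =
        477*(1 - e)^4 +
        324*(2*e - 1)*(1 - e)^3 +
        110*(2*e - 1)^2*(1 - e)^2 +
        92*(2*e - 1)^3*(1 - e) +
        27*(2*e - 1)^4"
      unfolding upper_poly_def by algebra
    show ?thesis
      using assms 2 by (intro ge_by_certificate[OF eq] add_nonneg_nonneg mult_nonneg_nonneg zero_le_power) simp_all
  next
    case 3
    have eq: "200 * (- upper_poly e 1 - (-199/100)) =
        27*(2 - e)^4 +
        232*(e - 1)*(2 - e)^3 +
        740*(e - 1)^2*(2 - e)^2 +
        768*(e - 1)^3*(2 - e) +
        198*(e - 1)^4"
      unfolding upper_poly_def by algebra
    show ?thesis
      using assms 3 by (intro ge_by_certificate[OF eq] add_nonneg_nonneg mult_nonneg_nonneg zero_le_power) simp_all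
  qed
qed

text \<open>At \<open>t = 1\<close> the energy inequality reads \<open>2 e (2 - e) < q\<close>. This
  contradicts the upper enclosure for \<open>e <= 8/5\<close>; for larger \<open>e\<close> the next
  lemma caps \<open>q\<close> by \<open>127/100\<close>.\<close>

lemma upper_poly_at_1_mid:
  fixes e :: real
  assumes "1 \<le> e" "e \<le> 8/5"
  shows "0 \<le> 2*e*(2 - e) - upper_poly e 1"
proof -
  have eq: "16200 * (2*e*(2 - e) - upper_poly e 1 - 0) =
      29*(8 - 5*e)^4 +
      952*(e - 1)*(8 - 5*e)^3 +
      8184*(e - 1)^2*(8 - 5*e)^2 +
      21592*(e - 1)^3*(8 - 5*e) +
      1400*(e - 1)^4"
    unfolding upper_poly_def by algebra
  show ?thesis
    using assms by (intro ge_by_certificate[OF eq] add_nonneg_nonneg mult_nonneg_nonneg zero_le_power) simp_all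
qed

lemma upper_poly_at_1_large:
  fixes e :: real
  assumes "8/5 \<le> e" "e \<le> 2"
  shows "-127/100 \<le> - upper_poly e 1"
proof -
  have eq: "1600 * (- upper_poly e 1 - (-127/100)) =
      75*(2 - e)^4 +
      5236*(5*e - 8)*(2 - e)^3 +
      2938*(5*e - 8)^2*(2 - e)^2 +
      516*(5*e - 8)^3*(2 - e) +
      27*(5*e - 8)^4"
    unfolding upper_poly_def by algebra
  show ?thesis
    using assms by (intro ge_by_certificate[OF eq] add_nonneg_nonneg mult_nonneg_nonneg zero_le_power) simp_all
qed

text \<open>An affine minorant in \<open>e\<close>, close to the polynomial at both ends of the
  range, which lets the final contradiction at \<open>t = 7/10\<close> be checked by linear
  arithmetic.\<close>

lemma lower_poly_end:
  fixes e :: real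
  assumes "7/5 \<le> e" "e \<le> 17/10"
  shows "0 \<le> lower_poly e (49/100) - (629/500 - 28/25*(e - 7/5))"
proof -
  have eq: "2025000 * (lower_poly e (49/100) - (629/500 - 28/25*(e - 7/5)) - 0) =
      1*(17 - 10*e)^4 +
      1790*(5*e - 7)*(17 - 10*e)^3 +
      5856*(5*e - 7)^2*(17 - 10*e)^2 +
      4730*(5*e - 7)^3*(17 - 10*e) +
      583*(5*e - 7)^4"
    unfolding lower_poly_def by algebra
  show ?thesis
    using assms by (intro ge_by_certificate[OF eq] add_nonneg_nonneg mult_nonneg_nonneg zero_le_power) simp_all
qed

lemma DERIV_upper_poly:
  assumes "(f has_real_derivative f') (at x)"
  shows "((\<lambda>x. upper_poly (f x) (x\<^sup>2)) has_real_derivative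
    (3 - 17/5*f x - 6/25*(f x)^2 + 7/10*(f x)^3 - 2/5*x\<^sup>2 - 7/25*x\<^sup>2*f x)*f'
    + (1 - 2/5*f x - 7/50*(f x)^2)*(2*x)) (at x)"
  unfolding upper_poly_def
  by (rule DERIV_cong, (rule derivative_intros assms)+, simp, algebra)

lemma DERIV_lower_poly:
  assumes "(f has_real_derivative f') (at x)"
  shows "((\<lambda>x. lower_poly (f x) (x\<^sup>2)) has_real_derivative
    (3 - 18/5*f x + 27/100*(f x)^2 + 3/10*(f x)^3 - 16/25*x\<^sup>2)*f'
    + (1 - 16/25*f x)*(2*x)) (at x)"
  unfolding lower_poly_def
  by (rule DERIV_cong, (rule derivative_intros assms)+, simp, algebra)

subsection \<open>The coefficients of the decay relation\<close>

text \<open>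
  The leading coefficient of the decaying solutions is the integral of \<open>exp (- 4 t y) / (1 + y)^2\<close>
  over positive \<open>y\<close>; \<open>decay_k\<close> is a convergent of its continued fraction that bounds it from below.
\<close>

definition decay_k :: "real \<Rightarrow> real" where "decay_k t = (2 * t + 2) / (8 * t\<^sup>2 + 12 * t + 3)"
text \<open>In the formal expansion of \<open>1 + t - e\<close> in powers of \<open>q\<close> the
  second coefficient solves \<open>t l' = l (1 + 6 t) - 3 k^2\<close>. The formula results from
  replacing \<open>t l'\<close> by \<open>- 3 l\<close>, which is a lower bound for
  \<open>t l'\<close> because \<open>t k\<close> is nondecreasing.\<close>

definition decay_l :: "real \<Rightarrow> real" where "decay_l t = 3 * (decay_k t)\<^sup>2 / (6 * t + 4)"

lemma decay_k_bounds:
  assumes "0 < t"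
  shows "0 < decay_k t" "decay_k t \<le> 1"
proof -
  have M: "0 < 8 * t\<^sup>2 + 12 * t + 3" using assms by (simp add: add_pos_pos)
  show "0 < decay_k t" unfolding decay_k_def using assms M by (intro divide_pos_pos) auto
  have "2 * t + 2 \<le> 8 * t\<^sup>2 + 12 * t + 3" using assms zero_le_power2[of t] by linarith
  then show "decay_k t \<le> 1" unfolding decay_k_def using M by (subst pos_divide_le_eq) auto
qed

lemma decay_l_bounds:
  assumes "0 < t"
  shows "0 < decay_l t" "decay_l t \<le> 1"
proof -
  have k: "0 < decay_k t" "decay_k t \<le> 1" using decay_k_bounds[OF assms] by auto
  show "0 < decay_l t" using k assms by (simp add: decay_l_def)
  have "(decay_k t)\<^sup>2 \<le> 1" using k by (simp add: power_le_one)
  then show "decay_l t \<le> 1" using assms by (simp add: decay_l_def)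
qed

text \<open>The exact first coefficient solves \<open>t k' = k (1 + 4 t) - 1\<close>; the convergent
  misses this by exactly \<open>3 / M^2\<close>, with a favourable sign. The last conclusion says
  that \<open>t k\<close> is nondecreasing.\<close>

lemma DERIV_decay_k:
  assumes "0 < t"
  obtains k' where "(decay_k has_real_derivative k') (at t)"
    "decay_k t * (1 + 4 * t) - 1 \<le> t * k'" "- decay_k t \<le> t * k'"
proof -
  define M where "M = 8 * t\<^sup>2 + 12 * t + 3"
  have M: "0 < M" using assms by (simp add: M_def add_pos_pos)
  have k: "decay_k t = (2 * t + 2) / M" by (simp add: decay_k_def M_def)
  define k' where "k' = - (16 * t\<^sup>2 + 32 * t + 18) / M\<^sup>2"
  have "(decay_k has_real_derivative (2 * M - (2 * t + 2) * (16 * t + 12)) / (M * M)) (at t)"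
    unfolding decay_k_def[abs_def] M_def using M
    by (auto intro!: derivative_eq_intros simp: M_def)
  moreover have "2 * M - (2 * t + 2) * (16 * t + 12) = - (16 * t\<^sup>2 + 32 * t + 18)"
    unfolding M_def by algebra
  ultimately have der: "(decay_k has_real_derivative k') (at t)"
    by (simp add: k'_def power2_eq_square)
  have "t * k' - (decay_k t * (1 + 4 * t) - 1)
      = (M\<^sup>2 - (2 * t + 2) * (1 + 4 * t) * M - t * (16 * t\<^sup>2 + 32 * t + 18)) / M\<^sup>2"
    using M by (simp add: k k'_def field_simps power2_eq_square)
  also have "M\<^sup>2 - (2 * t + 2) * (1 + 4 * t) * M - t * (16 * t\<^sup>2 + 32 * t + 18) = 3"
    unfolding M_def by (simp add: algebra_simps power2_eq_square)
  finally have 1: "decay_k t * (1 + 4 * t) - 1 \<le> t * k'" using M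
    by (smt (verit) divide_nonneg_pos zero_less_power)
  have "t * k' + decay_k t = ((2 * t + 2) * M - t * (16 * t\<^sup>2 + 32 * t + 18)) / M\<^sup>2"
    using M by (simp add: k k'_def field_simps power2_eq_square)
  also have "(2 * t + 2) * M - t * (16 * t\<^sup>2 + 32 * t + 18) = 8 * t\<^sup>2 + 12 * t + 6"
    unfolding M_def by algebra
  finally have "0 \<le> t * k' + decay_k t" using assms M by simp
  then show ?thesis using that der 1 by simp
qed

lemma DERIV_decay_l:
  assumes "0 < t"
  obtains l' where "(decay_l has_real_derivative l') (at t)"
    "decay_l t * (1 + 6 * t) - 3 * (decay_k t)\<^sup>2 \<le> t * l'"
proof -
  obtain k' where k': "(decay_k has_real_derivative k') (at t)" "- decay_k t \<le> t * k'"
    using DERIV_decay_k[OF assms] by blast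
  define N where "N = 6 * t + 4"
  define k where "k = decay_k t"
  have N: "0 < N" using assms by (simp add: N_def)
  have k: "0 < k" using decay_k_bounds[OF assms] by (simp add: k_def)
  define l' where "l' = (6 * k * k' * N - 18 * k\<^sup>2) / N\<^sup>2"
  have "(decay_l has_real_derivative l') (at t)"
    unfolding decay_l_def[abs_def] l'_def k_def N_def using N
    by (auto intro!: derivative_eq_intros k' simp: N_def power2_eq_square)
  moreover have "decay_l t * (1 + 6 * t) - 3 * (decay_k t)\<^sup>2 \<le> t * l'"
  proof -
    have l: "decay_l t = 3 * k\<^sup>2 / N" by (simp add: decay_l_def k_def N_def)
    have "t * l' - (3 * k\<^sup>2 / N * (1 + 6 * t) - 3 * k\<^sup>2)
        = (t * (6 * k * k' * N - 18 * k\<^sup>2) - 3 * k\<^sup>2 * N * (1 + 6 * t) + 3 * k\<^sup>2 * N\<^sup>2) / N\<^sup>2"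
      using N by (simp add: l'_def field_simps power2_eq_square)
    also have "t * (6 * k * k' * N - 18 * k\<^sup>2) - 3 * k\<^sup>2 * N * (1 + 6 * t) + 3 * k\<^sup>2 * N\<^sup>2
        = 6 * k * N * (t * k' + k) + 12 * k\<^sup>2"
      unfolding N_def by algebra
    finally have "t * l' - (3 * k\<^sup>2 / N * (1 + 6 * t) - 3 * k\<^sup>2)
        = (6 * k * N * (t * k' + k) + 12 * k\<^sup>2) / N\<^sup>2" .
    moreover have "0 \<le> t * k' + k" using k'(2) by (simp add: k_def)
    then have "0 \<le> 6 * k * N * (t * k' + k)" using k N by simp
    then have "0 \<le> (6 * k * N * (t * k' + k) + 12 * k\<^sup>2) / N\<^sup>2" by simp
    ultimately have "0 \<le> t * l' - (3 * k\<^sup>2 / N * (1 + 6 * t) - 3 * k\<^sup>2)" by simp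
    then show ?thesis by (simp add: l k_def)
  qed
  ultimately show ?thesis using that by blast
qed

subsection \<open>Behaviour at infinity and monotonicity\<close>

locale ground_state =
  fixes Q Q' :: "real \<Rightarrow> real"
  assumes cont_Q: "continuous_on {0..} Q"
    and Q_pos: "\<And>t. 0 \<le> t \<Longrightarrow> 0 < Q t"
    and DERIV_Q: "\<And>t. 0 < t \<Longrightarrow> (Q has_real_derivative Q' t) (at t)"
    and DERIV_Q': "\<And>t. 0 < t \<Longrightarrow>
      (Q' has_real_derivative (Q t - Q t ^ 3 - 2 / t * Q' t)) (at t)"
    and Q'_at_0: "(Q' \<longlongrightarrow> 0) (at_right 0)"
    and Q_at_top: "(Q \<longlongrightarrow> 0) at_top"
begin

text \<open>The substitution \<open>u = t Q\<close> removes the first-order term: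
  \<open>u'' = u (1 - Q^2)\<close>, and \<open>v\<close> is \<open>u'\<close>.\<close>

definition u :: "real \<Rightarrow> real" where "u t = t * Q t"
definition v :: "real \<Rightarrow> real" where "v t = Q t + t * Q' t"

lemma DERIV_u: "0 < t \<Longrightarrow> (u has_real_derivative v t) (at t)"
  unfolding u_def v_def
  by (auto intro!: derivative_eq_intros DERIV_Q)

lemma DERIV_v: "0 < t \<Longrightarrow> (v has_real_derivative t * (Q t - Q t ^ 3)) (at t)"
  unfolding v_def
  by (auto intro!: derivative_eq_intros DERIV_Q DERIV_Q' simp: field_simps)

lemma u_pos: "0 < t \<Longrightarrow> 0 < u t"
  using Q_pos[of t] by (simp add: u_def)

lemma Q_at_right_0: "(Q \<longlongrightarrow> Q 0) (at_right 0)"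
proof -
  have "continuous (at 0 within {0..}) Q"
    using cont_Q by (simp add: continuous_on_eq_continuous_within)
  then have "(Q \<longlongrightarrow> Q 0) (at 0 within {0..})"
    by (simp add: continuous_within)
  then show ?thesis
    by (rule tendsto_within_subset) auto
qed

text \<open>Once \<open>Q^2 <= 1/2\<close>, \<open>u\<close> is convex. A positive slope would then
  make \<open>u\<close> grow linearly, against \<open>Q = u / t\<close> tending to
  \<open>0\<close>.\<close>

lemma convex_at_top: "\<exists>T>0. \<forall>t\<ge>T. (Q t)\<^sup>2 \<le> 1/2 \<and> v t \<le> 0"
proof -
  have "\<forall>\<^sub>F t in at_top. Q t < 1/2"
    using Q_at_top by (rule order_tendstoD) simp
  then obtain T0 where T0: "\<And>t. T0 \<le> t \<Longrightarrow> Q t < 1/2"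
    by (auto simp: eventually_at_top_linorder)
  define T where "T = max T0 1"
  have T: "0 < T" "\<And>t. T \<le> t \<Longrightarrow> Q t < 1/2"
    using T0 by (auto simp: T_def)
  have sq: "(Q t)\<^sup>2 \<le> 1/2" if "T \<le> t" for t
  proof -
    have "0 < Q t" "Q t < 1/2" using T that Q_pos[of t] by auto
    then have "Q t * Q t \<le> (1/2) * 1" by (intro mult_mono) auto
    then show ?thesis by (simp add: power2_eq_square)
  qed
  have v_mono: "v s \<le> v t" if "T \<le> s" "s \<le> t" for s t
  proof (rule DERIV_nonneg_imp_nondecreasing[OF that(2)])
    fix x assume x: "s \<le> x" "x \<le> t"
    have "0 < x" using x that T by simp
    moreover have "0 \<le> x * (Q x - Q x ^ 3)"
    proof -
      have "x * (Q x - Q x ^ 3) = x * Q x * (1 - (Q x)\<^sup>2)" by algebra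
      then show ?thesis
        using sq[of x] Q_pos[of x] x that \<open>0 < x\<close> by simp
    qed
    ultimately show "\<exists>y. (v has_real_derivative y) (at x) \<and> 0 \<le> y"
      using DERIV_v by blast
  qed
  have "v s \<le> 0" if s: "T \<le> s" for s
  proof (rule ccontr)
    assume "\<not> v s \<le> 0"
    then have vs: "0 < v s" by simp
    have s0: "0 < s" using s T by simp
    have lin: "v s * (t - s) \<le> u t" if st: "s < t" for t
    proof -
      obtain z where z: "s < z" "z < t" "u t - u s = (t - s) * v z"
        using MVT2[of s t u v] st DERIV_u s0 by force
      have "(t - s) * v s \<le> (t - s) * v z"
        using v_mono[of s z] s z st by (intro mult_left_mono) auto
      then have "(t - s) * v s \<le> u t" using z(3) u_pos[OF s0] by linarith
      then show ?thesis by (simp add: mult.commute)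
    qed
    have "\<forall>\<^sub>F t in at_top. Q t < v s / 2"
      using Q_at_top vs by (intro order_tendstoD) auto
    then obtain N where N: "\<And>t. N \<le> t \<Longrightarrow> Q t < v s / 2"
      by (auto simp: eventually_at_top_linorder)
    \<comment> \<open>From \<open>2 * s\<close> on, \<open>t - s >= t / 2\<close>, so the linear
      growth of \<open>u\<close> gives \<open>Q t >= v s / 2\<close>.\<close>
    define t where "t = max N (2 * s)"
    have t: "s < t" "2 * s \<le> t" "Q t < v s / 2" using N s0 by (auto simp: t_def)
    have "v s * (t / 2) \<le> v s * (t - s)"
      using vs t by (intro mult_left_mono) auto
    also have "\<dots> \<le> t * Q t" using lin[OF t(1)] by (simp add: u_def)
    also have "\<dots> < t * (v s / 2)" using t s0 by (intro mult_strict_left_mono) auto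
    finally show False by simp
  qed
  then show ?thesis using sq T(1) by blast
qed

text \<open>Far out \<open>v\<close> is nondecreasing and nonpositive; if it stayed below
  \<open>- d\<close>, \<open>u\<close> would become negative. Since \<open>v'\<close> is at least
  \<open>u / 2\<close>, the decay of \<open>v\<close> carries over to \<open>u\<close>.\<close>

lemma v_at_top: "(v \<longlongrightarrow> 0) at_top"
  and u_at_top: "(u \<longlongrightarrow> 0) at_top"
proof -
  obtain T where T: "0 < T" "\<And>t. T \<le> t \<Longrightarrow> (Q t)\<^sup>2 \<le> 1/2" "\<And>t. T \<le> t \<Longrightarrow> v t \<le> 0"
    using convex_at_top by blast
  have v': "u t / 2 \<le> t * (Q t - Q t ^ 3)" if "T \<le> t" for t
  proof -
    have "t * (Q t - Q t ^ 3) = u t * (1 - (Q t)\<^sup>2)" by (simp add: u_def) algebra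
    moreover have "u t * (1/2) \<le> u t * (1 - (Q t)\<^sup>2)"
      using T(2)[OF that] u_pos[of t] T(1) that by (intro mult_left_mono) auto
    ultimately show ?thesis by simp
  qed
  have v_mono: "v s \<le> v t" if "T \<le> s" "s \<le> t" for s t
  proof (rule DERIV_nonneg_imp_nondecreasing[OF that(2)])
    fix x assume x: "s \<le> x" "x \<le> t"
    have "0 < x" using x that T by simp
    then show "\<exists>y. (v has_real_derivative y) (at x) \<and> 0 \<le> y"
      using DERIV_v v'[of x] u_pos[of x] x that by force
  qed
  have u_anti: "u t \<le> u s" if "T \<le> s" "s \<le> t" for s t
  proof (rule DERIV_nonpos_imp_nonincreasing[OF that(2)])
    fix x assume x: "s \<le> x" "x \<le> t"
    then show "\<exists>y. (u has_real_derivative y) (at x) \<and> y \<le> 0"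
      using DERIV_u[of x] T(3)[of x] T(1) that by auto
  qed
  have ex: "\<exists>t\<ge>T. - d < v t" if "0 < d" for d
  proof (rule ccontr)
    assume "\<not> ?thesis"
    then have d: "v t \<le> - d" if "T \<le> t" for t using that by force
    \<comment> \<open>Descending at rate \<open>d\<close> over this length uses up
      \<open>u T\<close> and a further \<open>d\<close>.\<close>
    define t where "t = T + u T / d + 1"
    have tT: "T < t" using u_pos[OF T(1)] \<open>0 < d\<close> by (simp add: t_def add_pos_pos add.assoc)
    obtain z where z: "T < z" "z < t" "u t - u T = (t - T) * v z"
      using MVT2[of T t u v] tT DERIV_u T(1) by force
    have "(t - T) * v z \<le> (t - T) * (- d)"
      using d[of z] z tT by (intro mult_left_mono) auto
    also have "\<dots> = - u T - d" using \<open>0 < d\<close> by (simp add: t_def field_simps)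
    finally have "u t \<le> - d" using z by simp
    then show False using u_pos[of t] tT T(1) \<open>0 < d\<close> by simp
  qed
  show v0: "(v \<longlongrightarrow> 0) at_top"
  proof (rule tendstoI)
    fix d :: real assume "0 < d"
    then obtain t where t: "T \<le> t" "- d < v t" using ex by blast
    show "\<forall>\<^sub>F x in at_top. dist (v x) 0 < d"
      unfolding eventually_at_top_linorder
    proof (intro exI allI impI)
      fix x assume "t \<le> x"
      then show "dist (v x) 0 < d"
        using v_mono[OF t(1), of x] T(3)[of x] t by simp
    qed
  qed
  have bound: "u (t + 1) \<le> - 2 * v t" if t: "T \<le> t" for t
  proof -
    obtain z where z: "t < z" "z < t + 1"
      "v (t + 1) - v t = (t + 1 - t) * (z * (Q z - Q z ^ 3))"
      using MVT2[of t "t + 1" v "\<lambda>z. z * (Q z - Q z ^ 3)"] DERIV_v T(1) t by force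
    have "u (t + 1) / 2 \<le> u z / 2" using u_anti[of z "t + 1"] z t by simp
    also have "\<dots> \<le> v (t + 1) - v t" using v'[of z] z t by simp
    also have "\<dots> \<le> - v t" using T(3)[of "t + 1"] t by simp
    finally show ?thesis by simp
  qed
  have "((\<lambda>t. u (t + 1)) \<longlongrightarrow> 0) at_top"
  proof (rule real_tendsto_sandwich)
    show "\<forall>\<^sub>F t in at_top. 0 \<le> u (t + 1)"
      using eventually_ge_at_top[of 0] by eventually_elim (use u_pos in \<open>auto intro: less_imp_le\<close>)
    show "\<forall>\<^sub>F t in at_top. u (t + 1) \<le> - 2 * v t"
      using eventually_ge_at_top[of T] by eventually_elim (use bound in auto)
    show "((\<lambda>t. - 2 * v t) \<longlongrightarrow> 0) at_top"
      using tendsto_mult[OF tendsto_const[of "-2"] v0] by simp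
  qed simp
  then have "((\<lambda>t. u ((t - 1) + 1)) \<longlongrightarrow> 0) at_top"
    by (rule filterlim_compose) (use filterlim_tendsto_add_at_top[OF tendsto_const[of "-1::real"] filterlim_ident] in simp)
  then show "(u \<longlongrightarrow> 0) at_top" by simp
qed

section \<open>Quantities with a limit at infinity and a monotone evolution; the sign of
  \<open>Q'\<close>\<close>

text \<open>For the linear equation \<open>u'' = u\<close>, \<open>exp (- t) * (u + v)\<close> is
  constant and measures the growing mode. The cubic term makes it decrease, and its limit is
  \<open>0\<close>. As \<open>u + v = Q (1 + t - e)\<close>, this is the bound
  \<open>e < 1 + t\<close>.\<close>

lemma u_plus_v_pos:
  assumes "0 < t"
  shows "0 < u t + v t"
proof -
  have "0 < exp (- t) * (u t + v t)"
  proof (rule pos_if_decreasing_to_0[OF assms])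
    fix x :: real assume x: "0 < x"
    have "((\<lambda>t. exp (- t) * (u t + v t)) has_real_derivative
        - exp (- x) * (u x + v x) + exp (- x) * (v x + x * (Q x - Q x ^ 3))) (at x)"
      using x by (auto intro!: derivative_eq_intros DERIV_u DERIV_v simp: algebra_simps)
    also have "- exp (- x) * (u x + v x) + exp (- x) * (v x + x * (Q x - Q x ^ 3))
        = - (exp (- x) * (x * Q x ^ 3))"
      by (simp add: u_def algebra_simps)
    finally show "((\<lambda>t. exp (- t) * (u t + v t)) has_real_derivative
        - (exp (- x) * (x * Q x ^ 3))) (at x)" .
    show "- (exp (- x) * (x * Q x ^ 3)) < 0"
      using x Q_pos[of x] by simp
  next
    have "((\<lambda>t::real. exp (- t)) \<longlongrightarrow> 0) at_top"
      by (rule filterlim_compose[OF exp_at_bot filterlim_uminus_at_bot_at_top])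
    from tendsto_mult[OF this tendsto_add[OF u_at_top v_at_top]]
    show "((\<lambda>t. exp (- t) * (u t + v t)) \<longlongrightarrow> 0) at_top" by simp
  qed
  then show ?thesis by (simp add: zero_less_mult_iff)
qed

text \<open>\<open>F\<close> is twice the energy of \<open>u'' = u - u^3 / t^2\<close>; only the
  explicit \<open>t\<close> in the potential changes it, at the rate \<open>- t Q^4\<close>.\<close>

lemma energy_u_pos:
  assumes "0 < t"
  shows "(u t)\<^sup>2 * (1 - (Q t)\<^sup>2 / 2) < (v t)\<^sup>2"
proof -
  define F where "F = (\<lambda>t. (v t)\<^sup>2 - (u t)\<^sup>2 + (u t)\<^sup>2 * (Q t)\<^sup>2 / 2)"
  have "0 < F t"
  proof (rule pos_if_decreasing_to_0[OF assms])
    fix x :: real assume x: "0 < x"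
    have "(F has_real_derivative 2 * v x * (x * (Q x - Q x ^ 3)) - 2 * u x * v x
        + (2 * u x * v x * (Q x)\<^sup>2 + (u x)\<^sup>2 * (2 * Q x * Q' x)) / 2) (at x)"
      unfolding F_def using x
      by (auto intro!: derivative_eq_intros DERIV_u DERIV_v DERIV_Q)
    moreover have "2 * v x * (x * (Q x - Q x ^ 3)) - 2 * u x * v x
        + (2 * u x * v x * (Q x)\<^sup>2 + (u x)\<^sup>2 * (2 * Q x * Q' x)) / 2 = - (x * Q x ^ 4)"
      unfolding u_def v_def by algebra
    ultimately show "(F has_real_derivative - (x * Q x ^ 4)) (at x)" by simp
    show "- (x * Q x ^ 4) < 0" using x Q_pos[of x] by simp
  next
    have "(F \<longlongrightarrow> 0\<^sup>2 - 0\<^sup>2 + 0\<^sup>2 * 0\<^sup>2 / 2) at_top"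
      unfolding F_def by (intro tendsto_intros u_at_top v_at_top Q_at_top) simp
    then show "(F \<longlongrightarrow> 0) at_top" by simp
  qed
  then show ?thesis by (simp add: F_def algebra_simps)
qed

lemma Q'_at_top: "(Q' \<longlongrightarrow> 0) at_top"
proof -
  have "((\<lambda>t. (v t - Q t) * inverse t) \<longlongrightarrow> (0 - 0) * 0) at_top"
    by (intro tendsto_intros v_at_top Q_at_top tendsto_inverse_0_at_top filterlim_ident)
  then show ?thesis
    by (simp, elim Lim_transform_eventually)
      (use eventually_gt_at_top[of 0] in \<open>eventually_elim, simp add: v_def field_simps\<close>)
qed

text \<open>The term \<open>(2 / t) Q'\<close> acts as friction, so the energy decreases to its
  limit \<open>0\<close>.\<close>

lemma energy_Q_nonneg:
  assumes "0 < t"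
  shows "0 \<le> (Q' t)\<^sup>2 / 2 + Q t ^ 4 / 4 - (Q t)\<^sup>2 / 2"
proof -
  define E where "E = (\<lambda>t. (Q' t)\<^sup>2 / 2 + Q t ^ 4 / 4 - (Q t)\<^sup>2 / 2)"
  have der: "(E has_real_derivative - 2 / x * (Q' x)\<^sup>2) (at x)" if "0 < x" for x
  proof -
    have "(E has_real_derivative (2 * Q' x * (Q x - Q x ^ 3 - 2 / x * Q' x)) / 2
        + (4 * Q x ^ 3 * Q' x) / 4 - (2 * Q x * Q' x) / 2) (at x)"
      unfolding E_def using that
      by (auto intro!: derivative_eq_intros DERIV_Q DERIV_Q')
    moreover have "(2 * Q' x * (Q x - Q x ^ 3 - 2 / x * Q' x)) / 2
        + (4 * Q x ^ 3 * Q' x) / 4 - (2 * Q x * Q' x) / 2 = - 2 / x * (Q' x)\<^sup>2"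
      using that by (simp add: field_simps power2_eq_square)
    ultimately show ?thesis by simp
  qed
  have "(E \<longlongrightarrow> 0\<^sup>2 / 2 + 0 ^ 4 / 4 - 0\<^sup>2 / 2) at_top"
    unfolding E_def by (intro tendsto_intros Q'_at_top Q_at_top) simp_all
  then have lim: "(E \<longlongrightarrow> 0) at_top" by simp
  have "0 \<le> E t"
  proof (rule tendsto_upperbound[OF lim])
    have "E x \<le> E t" if "t \<le> x" for x
    proof (rule DERIV_nonpos_imp_nonincreasing[OF that])
      fix z assume "t \<le> z" "z \<le> x"
      then have "0 < z" using assms by simp
      then show "\<exists>y. (E has_real_derivative y) (at z) \<and> y \<le> 0"
        using der[of z] by (intro exI[of _ "- 2 / z * (Q' z)\<^sup>2"]) simp
    qed
    then show "\<forall>\<^sub>F x in at_top. E x \<le> E t"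
      by (auto simp: eventually_at_top_linorder)
  qed simp
  then show ?thesis by (simp add: E_def)
qed

text \<open>At a zero of \<open>Q'\<close> the energy forces \<open>Q > 1\<close>, hence a negative
  second derivative, so \<open>- Q'\<close> crosses zero only upwards. It remains to start the
  argument near the origin and to exclude zeros.\<close>

lemma Q'_neg:
  assumes "0 < t"
  shows "Q' t < 0"
proof -
  have source: "Q x - Q x ^ 3 < 0" if "1 < Q x" for x
  proof -
    have "Q x - Q x ^ 3 = - (Q x * ((Q x)\<^sup>2 - 1))" by algebra
    moreover have "1 < (Q x)\<^sup>2" using that by (simp add: one_less_power)
    ultimately show ?thesis using that by simp
  qed
  have zero: "0 < - (Q x - Q x ^ 3 - 2 / x * Q' x)" if "0 < x" "- Q' x = 0" for x
  proof -
    have "1 < Q x"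
      using energy_Q_nonneg[OF that(1)] that Q_pos[of x] by (intro critical_energy) auto
    then show ?thesis using source that by simp
  qed
  have der: "((\<lambda>x. - Q' x) has_real_derivative - (Q x - Q x ^ 3 - 2 / x * Q' x)) (at x)"
    if "0 < x" for x
    using DERIV_minus[OF DERIV_Q'[OF that]] .
  have "1 < Q 0"
  proof (rule critical_energy)
    have "((\<lambda>t. (Q' t)\<^sup>2 / 2 + Q t ^ 4 / 4 - (Q t)\<^sup>2 / 2)
        \<longlongrightarrow> 0\<^sup>2 / 2 + Q 0 ^ 4 / 4 - (Q 0)\<^sup>2 / 2) (at_right 0)"
      by (intro tendsto_intros Q'_at_0 Q_at_right_0) simp_all
    moreover have "\<forall>\<^sub>F t in at_right 0. 0 \<le> (Q' t)\<^sup>2 / 2 + Q t ^ 4 / 4 - (Q t)\<^sup>2 / 2"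
      using eventually_at_right_less[of 0] by eventually_elim (rule energy_Q_nonneg)
    ultimately have "0 \<le> 0\<^sup>2 / 2 + Q 0 ^ 4 / 4 - (Q 0)\<^sup>2 / 2"
      by (rule tendsto_lowerbound) simp
    then show "0 \<le> Q 0 ^ 4 / 4 - (Q 0)\<^sup>2 / 2" by simp
  qed (use Q_pos in auto)
  then have "\<forall>\<^sub>F x in at_right 0. 1 < Q x"
    using Q_at_right_0 by (auto dest: order_tendstoD)
  then obtain d where d: "0 < d" "\<And>x. 0 < x \<Longrightarrow> x < d \<Longrightarrow> 1 < Q x"
    by (auto simp: eventually_at_right_field)
  \<comment> \<open>Near the origin \<open>Q > 1\<close>, so \<open>x^2 Q'\<close>, which tends to
    \<open>0\<close>, has negative derivative \<open>x^2 (Q - Q^3)\<close>.\<close>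
  have near: "0 \<le> - Q' s" if s: "0 < s" "s < d" for s
  proof -
    define g where "g = (\<lambda>x. x\<^sup>2 * Q' x)"
    have dg: "(g has_real_derivative x\<^sup>2 * (Q x - Q x ^ 3)) (at x)" if "0 < x" for x
      unfolding g_def using that
      by (auto intro!: derivative_eq_intros DERIV_Q' simp: field_simps power2_eq_square)
    have "(g \<longlongrightarrow> 0\<^sup>2 * 0) (at_right 0)"
      unfolding g_def by (intro tendsto_intros Q'_at_0)
    then have "g s \<le> 0\<^sup>2 * 0"
    proof (rule tendsto_lowerbound)
      have "g s \<le> g x" if "0 < x" "x < s" for x
      proof (rule DERIV_nonpos_imp_nonincreasing[of x s g])
        fix z assume "x \<le> z" "z \<le> s"
        then have z: "0 < z" "z < d" using that s by auto
        show "\<exists>y. (g has_real_derivative y) (at z) \<and> y \<le> 0"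
          using dg[OF z(1)] source[OF d(2)[OF z]] mult_nonneg_nonpos[of "z\<^sup>2" "Q z - Q z ^ 3"]
          by auto
      qed (use that in simp)
      then show "\<forall>\<^sub>F x in at_right 0. g s \<le> g x"
        using eventually_at_right_real[OF s(1)] by (auto elim: eventually_mono)
    qed simp
    then show ?thesis using s by (simp add: g_def mult_le_0_iff)
  qed
  have nonneg: "0 \<le> - Q' x" if "0 < x" for x
  proof (cases "x < d")
    case True
    then show ?thesis using near that by blast
  next
    case False
    show ?thesis
    proof (rule nonneg_after_upward_zeros[of "d / 2" x "\<lambda>x. - Q' x"
          "\<lambda>x. - (Q x - Q x ^ 3 - 2 / x * Q' x)"])
      show "d / 2 \<le> x" "0 \<le> - Q' (d / 2)"
        using d(1) False near[of "d / 2"] by auto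
      fix y assume "d / 2 \<le> y"
      then have y: "0 < y" using d(1) by simp
      show "((\<lambda>x. - Q' x) has_real_derivative - (Q y - Q y ^ 3 - 2 / y * Q' y)) (at y)"
        by (rule der[OF y])
      show "0 < - (Q y - Q y ^ 3 - 2 / y * Q' y)" if "- Q' y = 0"
        by (rule zero[OF y that])
    qed
  qed
  show ?thesis
  proof (rule ccontr)
    assume "\<not> Q' t < 0"
    then have 0: "- Q' t = 0" using nonneg[OF assms] by simp
    \<comment> \<open>At a zero \<open>- Q'\<close> increases strictly, so it would be negative just
      before, against \<open>nonneg\<close>.\<close>
    obtain h where h: "0 < h" "\<And>x. 0 < x \<Longrightarrow> x < h \<Longrightarrow> - Q' (t - x) < - Q' t"
      using DERIV_pos_inc_left[OF der[OF assms] zero[OF assms 0]] by blast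
    define x where "x = min (h / 2) (t / 2)"
    have "0 < x" "x < h" "x < t" using h assms by (auto simp: x_def)
    then show False using h(2)[of x] nonneg[of "t - x"] 0 by simp
  qed
qed

text \<open>
  In the variable \<open>log t\<close> the pair \<open>(e, q)\<close> satisfies a planar system that is
  autonomous up to the term \<open>t^2\<close>.
\<close>

definition e :: "real \<Rightarrow> real" where "e t = - (t * Q' t / Q t)"
definition q :: "real \<Rightarrow> real" where "q t = (t * Q t)\<^sup>2"

lemma DERIV_q: "0 < t \<Longrightarrow> (q has_real_derivative 2 * (1 - e t) * q t / t) (at t)"
  unfolding q_def e_def using Q_pos[of t]
  by (auto intro!: derivative_eq_intros DERIV_Q simp: field_simps power2_eq_square)

lemma DERIV_e: "0 < t \<Longrightarrow> (e has_real_derivative (q t - t\<^sup>2 - e t + (e t)\<^sup>2) / t) (at t)"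
  unfolding q_def e_def using Q_pos[of t]
  by (auto intro!: derivative_eq_intros DERIV_Q DERIV_Q'
      simp: field_simps power2_eq_square power3_eq_cube)

lemma q_pos: "0 < t \<Longrightarrow> 0 < q t"
  using Q_pos[of t] by (simp add: q_def)

lemma e_pos: "0 < t \<Longrightarrow> 0 < e t"
  using Q_pos[of t] Q'_neg[of t] by (simp add: e_def divide_neg_pos mult_pos_neg)

lemma e_less: "0 < t \<Longrightarrow> e t < 1 + t"
  using Q_pos[of t] u_plus_v_pos[of t] by (simp add: e_def u_def v_def field_simps)

lemma q_at_0: "(q \<longlongrightarrow> 0) (at_right 0)"
proof -
  have "(q \<longlongrightarrow> (0 * Q 0)\<^sup>2) (at_right 0)"
    unfolding q_def by (intro tendsto_intros Q_at_right_0)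
  then show ?thesis by simp
qed

lemma e_at_0: "(e \<longlongrightarrow> 0) (at_right 0)"
proof -
  have "(e \<longlongrightarrow> - (0 * 0 / Q 0)) (at_right 0)"
    unfolding e_def using Q_pos[of 0] by (intro tendsto_intros Q_at_right_0 Q'_at_0) auto
  then show ?thesis by simp
qed

lemma q_at_top: "(q \<longlongrightarrow> 0) at_top"
proof -
  have "((\<lambda>t. (u t)\<^sup>2) \<longlongrightarrow> 0\<^sup>2) at_top"
    by (intro tendsto_intros u_at_top)
  then show ?thesis by (simp add: q_def[abs_def] u_def)
qed

subsection \<open>Enclosures along the solution\<close>

text \<open>The difference \<open>D\<close> satisfies \<open>x D' = c D - R\<close> exactly, with
  \<open>R < 0\<close> the residual. At zeros of \<open>D\<close> this is positive; near the origin
  \<open>c\<close> tends to \<open>2 - 3 = -1\<close>, so a negative \<open>D\<close> would increase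
  as well.\<close>

lemma q_le_upper_poly:
  assumes t: "0 < t" "t \<le> 1"
  shows "q t \<le> upper_poly (e t) (t\<^sup>2)"
proof -
  define c where "c = (\<lambda>x. 2*(1 - e x)
    - (3 - 17/5*e x - 6/25*(e x)^2 + 7/10*(e x)^3 - 2/5*x\<^sup>2 - 7/25*x\<^sup>2*e x))"
  define R where "R = (\<lambda>x. 2*(1 - e x)*upper_poly (e x) (x\<^sup>2)
    - (3 - 17/5*e x - 6/25*(e x)^2 + 7/10*(e x)^3 - 2/5*x\<^sup>2 - 7/25*x\<^sup>2*e x)
      *(upper_poly (e x) (x\<^sup>2) - x\<^sup>2 - e x + (e x)^2)
    - 2*x\<^sup>2*(1 - 2/5*e x - 7/50*(e x)^2))"
  define D where "D = (\<lambda>x. upper_poly (e x) (x\<^sup>2) - q x)"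
  have R: "R x < 0" if "0 < x" "x \<le> t" for x
    unfolding R_def using that t e_pos[of x] e_less[of x]
    by (intro upper_poly_residual) (auto simp: power_le_one)
  have "0 \<le> D t"
  proof (rule nonneg_from_origin[OF t(1), of D "\<lambda>x. (D x * c x - R x) / x"])
    fix x assume x: "0 < x" "x \<le> t"
    have "(D has_real_derivative
        (3 - 17/5*e x - 6/25*(e x)^2 + 7/10*(e x)^3 - 2/5*x\<^sup>2 - 7/25*x\<^sup>2*e x)
          *((q x - x\<^sup>2 - e x + (e x)\<^sup>2) / x)
        + (1 - 2/5*e x - 7/50*(e x)^2)*(2*x) - 2 * (1 - e x) * q x / x) (at x)"
      unfolding D_def using x by (intro DERIV_diff DERIV_upper_poly DERIV_e DERIV_q)
    moreover have "(3 - 17/5*e x - 6/25*(e x)^2 + 7/10*(e x)^3 - 2/5*x\<^sup>2 - 7/25*x\<^sup>2*e x)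
          *((q x - x\<^sup>2 - e x + (e x)\<^sup>2) / x)
        + (1 - 2/5*e x - 7/50*(e x)^2)*(2*x) - 2 * (1 - e x) * q x / x
        = ((3 - 17/5*e x - 6/25*(e x)^2 + 7/10*(e x)^3 - 2/5*x\<^sup>2 - 7/25*x\<^sup>2*e x)
          *(q x - x\<^sup>2 - e x + (e x)\<^sup>2)
        + (1 - 2/5*e x - 7/50*(e x)^2)*(2*x\<^sup>2) - 2 * (1 - e x) * q x) / x"
    proof -
      have "a*(b / x) + c*(2*x) - d / x = (a*b + c*(2*x\<^sup>2) - d) / x" for a b c d :: real
        using x by (simp add: field_simps power2_eq_square)
      then show ?thesis .
    qed
    moreover have "(3 - 17/5*e x - 6/25*(e x)^2 + 7/10*(e x)^3 - 2/5*x\<^sup>2 - 7/25*x\<^sup>2*e x)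
          *(q x - x\<^sup>2 - e x + (e x)\<^sup>2)
        + (1 - 2/5*e x - 7/50*(e x)^2)*(2*x\<^sup>2) - 2 * (1 - e x) * q x = D x * c x - R x"
      unfolding D_def c_def R_def by algebra
    ultimately show "(D has_real_derivative (D x * c x - R x) / x) (at x)" by simp
    show "0 < (D x * c x - R x) / x" if "D x = 0"
      using R[OF x] x that by (simp add: divide_neg_pos)
  next
    have "(D \<longlongrightarrow> upper_poly 0 (0\<^sup>2) - 0) (at_right 0)"
      unfolding D_def upper_poly_def by (intro tendsto_intros e_at_0 q_at_0)
    then show "(D \<longlongrightarrow> 0) (at_right 0)" by (simp add: upper_poly_def)
    have "(c \<longlongrightarrow> 2*(1 - 0)
        - (3 - 17/5*0 - 6/25*0^2 + 7/10*0^3 - 2/5*0\<^sup>2 - 7/25*0\<^sup>2*0)) (at_right 0)"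
      unfolding c_def by (intro tendsto_intros e_at_0)
    then have "\<forall>\<^sub>F x in at_right 0. c x < 0"
      by (rule order_tendstoD) simp
    then show "\<forall>\<^sub>F x in at_right 0. D x < 0 \<longrightarrow> 0 < (D x * c x - R x) / x"
      using eventually_at_right_real[OF t(1)]
    proof eventually_elim
      case (elim x)
      then show ?case using R[of x] mult_neg_neg[of "D x" "c x"] by auto
    qed
  qed
  then show ?thesis by (simp add: D_def)
qed

text \<open>The mirror image of the upper enclosure: now \<open>x D' = c D + R\<close> with
  \<open>R > 0\<close>.\<close>

lemma lower_poly_le_q:
  assumes t: "0 < t" "t \<le> 7/10"
  shows "lower_poly (e t) (t\<^sup>2) \<le> q t"
proof -
  define c where "c = (\<lambda>x. 2*(1 - e x)
    - (3 - 18/5*e x + 27/100*(e x)^2 + 3/10*(e x)^3 - 16/25*x\<^sup>2))"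
  define R where "R = (\<lambda>x. 2*(1 - e x)*lower_poly (e x) (x\<^sup>2)
    - (3 - 18/5*e x + 27/100*(e x)^2 + 3/10*(e x)^3 - 16/25*x\<^sup>2)
      *(lower_poly (e x) (x\<^sup>2) - x\<^sup>2 - e x + (e x)^2)
    - 2*x\<^sup>2*(1 - 16/25*e x))"
  define D where "D = (\<lambda>x. q x - lower_poly (e x) (x\<^sup>2))"
  have R: "0 < R x" if "0 < x" "x \<le> t" for x
  proof -
    have "x\<^sup>2 \<le> (7/10)\<^sup>2" using that t by (intro power_mono) auto
    then show ?thesis
      unfolding R_def using that t e_pos[of x] e_less[of x]
      by (intro lower_poly_residual) (auto simp: power2_eq_square)
  qed
  have "0 \<le> D t"
  proof (rule nonneg_from_origin[OF t(1), of D "\<lambda>x. (D x * c x + R x) / x"])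
    fix x assume x: "0 < x" "x \<le> t"
    have "(D has_real_derivative
        2 * (1 - e x) * q x / x
        - ((3 - 18/5*e x + 27/100*(e x)^2 + 3/10*(e x)^3 - 16/25*x\<^sup>2)
          *((q x - x\<^sup>2 - e x + (e x)\<^sup>2) / x)
        + (1 - 16/25*e x)*(2*x))) (at x)"
      unfolding D_def using x by (intro DERIV_diff DERIV_lower_poly DERIV_e DERIV_q)
    moreover have "2 * (1 - e x) * q x / x
        - ((3 - 18/5*e x + 27/100*(e x)^2 + 3/10*(e x)^3 - 16/25*x\<^sup>2)
          *((q x - x\<^sup>2 - e x + (e x)\<^sup>2) / x)
        + (1 - 16/25*e x)*(2*x))
        = (2 * (1 - e x) * q x
        - (3 - 18/5*e x + 27/100*(e x)^2 + 3/10*(e x)^3 - 16/25*x\<^sup>2)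
          *(q x - x\<^sup>2 - e x + (e x)\<^sup>2)
        - (1 - 16/25*e x)*(2*x\<^sup>2)) / x"
    proof -
      have "d / x - (a*(b / x) + c*(2*x)) = (d - a*b - c*(2*x\<^sup>2)) / x" for a b c d :: real
        using x by (simp add: field_simps power2_eq_square)
      then show ?thesis .
    qed
    moreover have "2 * (1 - e x) * q x
        - (3 - 18/5*e x + 27/100*(e x)^2 + 3/10*(e x)^3 - 16/25*x\<^sup>2)
          *(q x - x\<^sup>2 - e x + (e x)\<^sup>2)
        - (1 - 16/25*e x)*(2*x\<^sup>2) = D x * c x + R x"
      unfolding D_def c_def R_def by algebra
    ultimately show "(D has_real_derivative (D x * c x + R x) / x) (at x)" by simp
    show "0 < (D x * c x + R x) / x" if "D x = 0"
      using R[OF x] x that by simp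
  next
    have "(D \<longlongrightarrow> 0 - lower_poly 0 (0\<^sup>2)) (at_right 0)"
      unfolding D_def lower_poly_def by (intro tendsto_intros e_at_0 q_at_0)
    then show "(D \<longlongrightarrow> 0) (at_right 0)" by (simp add: lower_poly_def)
    have "(c \<longlongrightarrow> 2*(1 - 0)
        - (3 - 18/5*0 + 27/100*0^2 + 3/10*0^3 - 16/25*0\<^sup>2)) (at_right 0)"
      unfolding c_def by (intro tendsto_intros e_at_0)
    then have "\<forall>\<^sub>F x in at_right 0. c x < 0"
      by (rule order_tendstoD) simp
    then show "\<forall>\<^sub>F x in at_right 0. D x < 0 \<longrightarrow> 0 < (D x * c x + R x) / x"
      using eventually_at_right_real[OF t(1)]
    proof eventually_elim
      case (elim x)
      then show ?case using R[of x] mult_neg_neg[of "D x" "c x"] by auto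
    qed
  qed
  then show ?thesis by (simp add: D_def)
qed

text \<open>Where \<open>e\<close> meets \<open>p\<close>, the lower enclosure bounds the derivative
  of \<open>e\<close> from below by a quantity exceeding that of \<open>p\<close>.\<close>

lemma e_barrier:
  assumes "0 < a" "a \<le> b" "b \<le> 7/10" and start: "p a \<le> e a"
    and der: "\<And>t. a \<le> t \<Longrightarrow> t \<le> b \<Longrightarrow> (p has_real_derivative p' t) (at t)"
    and slope: "\<And>t. a \<le> t \<Longrightarrow> t \<le> b \<Longrightarrow>
      t * p' t < lower_poly (p t) (t\<^sup>2) - t\<^sup>2 - p t + (p t)\<^sup>2"
  shows "p b \<le> e b"
proof -
  have "0 \<le> e b - p b"
  proof (rule nonneg_after_upward_zeros[of a b "\<lambda>t. e t - p t"
        "\<lambda>t. (q t - t\<^sup>2 - e t + (e t)\<^sup>2) / t - p' t"])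
    fix x assume x: "a \<le> x" "x \<le> b"
    then show "((\<lambda>t. e t - p t) has_real_derivative
        (q x - x\<^sup>2 - e x + (e x)\<^sup>2) / x - p' x) (at x)"
      using assms(1) by (intro DERIV_diff DERIV_e der) auto
  next
    fix x assume x: "a \<le> x" "x \<le> b" "e x - p x = 0"
    have "x * p' x < q x - x\<^sup>2 - e x + (e x)\<^sup>2"
      using slope[of x] lower_poly_le_q[of x] x assms(1,3) by simp
    then show "0 < (q x - x\<^sup>2 - e x + (e x)\<^sup>2) / x - p' x"
      using x assms(1) by (simp add: field_simps)
  qed (use assms in auto)
  then show ?thesis by simp
qed

section \<open>The sharpened decay relation\<close>

text \<open>A positive excess \<open>D\<close> cannot become negative later, since its zeros are
  crossed upwards. Far out it would strictly increase, but there \<open>D <= 2 q\<close>, which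
  tends to \<open>0\<close>.\<close>

lemma decay_bound:
  assumes "0 < t"
  shows "decay_k t * q t + decay_l t * (q t)\<^sup>2 \<le> 1 + t - e t"
proof (rule ccontr)
  define D where "D = (\<lambda>x. decay_k x * q x + decay_l x * (q x)\<^sup>2 - (1 + x - e x))"
  define c where "c = (\<lambda>x. 1 + 2*x - (1 + x - e x) - (decay_k x * q x + decay_l x * (q x)\<^sup>2)
    - 2 * decay_k x * q x - 4 * decay_l x * (q x)\<^sup>2)"
  assume "\<not> ?thesis"
  then have D_t: "0 < D t" by (simp add: D_def)
  have "\<exists>D'. (D has_real_derivative D') (at x) \<and> D x * c x < x * D'" if x: "0 < x" for x
  proof -
    obtain k' where k': "(decay_k has_real_derivative k') (at x)"
      "decay_k x * (1 + 4 * x) - 1 \<le> x * k'"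
      using DERIV_decay_k[OF x] by blast
    obtain l' where l': "(decay_l has_real_derivative l') (at x)"
      "decay_l x * (1 + 6 * x) - 3 * (decay_k x)\<^sup>2 \<le> x * l'"
      using DERIV_decay_l[OF x] by blast
    have q: "0 < q x" by (rule q_pos[OF x])
    define k l where "k = decay_k x" and "l = decay_l x"
    have kl: "0 < k" "0 < l"
      using decay_k_bounds(1)[OF x] decay_l_bounds(1)[OF x] by (auto simp: k_def l_def)
    define D' where "D' = (k' * q x + k * (2 * (1 - e x) * q x / x))
      + (l' * (q x)\<^sup>2 + l * (2 * q x * (2 * (1 - e x) * q x / x)))
      - (1 - (q x - x\<^sup>2 - e x + (e x)\<^sup>2) / x)"
    have "(D has_real_derivative D') (at x)"
      unfolding D_def D'_def k_def l_def using x
      by (auto intro!: derivative_eq_intros k' l' DERIV_q DERIV_e simp: mult_ac)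
    moreover have "D x * c x < x * D'"
    proof -
      have "x * D' = x * k' * q x + x * l' * (q x)\<^sup>2 + 2 * k * (1 - e x) * q x
          + 4 * l * (1 - e x) * (q x)\<^sup>2 - x + (q x - x\<^sup>2 - e x + (e x)\<^sup>2)"
        using x by (simp add: D'_def field_simps power2_eq_square)
      moreover have "(k * (1 + 4 * x) - 1) * q x \<le> x * k' * q x"
        "(l * (1 + 6 * x) - 3 * k\<^sup>2) * (q x)\<^sup>2 \<le> x * l' * (q x)\<^sup>2"
        using k'(2) l'(2) q by (auto simp: k_def l_def intro!: mult_right_mono)
      \<comment> \<open>The orders \<open>q\<close> and \<open>q^2\<close> cancel by the choice of
        coefficients; the positive cubic and quartic terms are left over from truncating the
        expansion.\<close>
      moreover have "(k * (1 + 4 * x) - 1) * q x + (l * (1 + 6 * x) - 3 * k\<^sup>2) * (q x)\<^sup>2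
          + 2 * k * (1 - e x) * q x + 4 * l * (1 - e x) * (q x)\<^sup>2 - x + (q x - x\<^sup>2 - e x + (e x)\<^sup>2)
          = D x * c x + (8 * k * l * q x ^ 3 + 5 * l\<^sup>2 * q x ^ 4)"
        unfolding D_def c_def k_def[symmetric] l_def[symmetric] by algebra
      moreover have "0 < 8 * k * l * q x ^ 3 + 5 * l\<^sup>2 * q x ^ 4"
        using kl q by (intro add_pos_pos mult_pos_pos) auto
      ultimately show ?thesis by linarith
    qed
    ultimately show ?thesis by blast
  qed
  then obtain D' where D': "\<And>x. 0 < x \<Longrightarrow> (D has_real_derivative D' x) (at x)"
    "\<And>x. 0 < x \<Longrightarrow> D x * c x < x * D' x"
    by metis
  have D_nonneg: "0 \<le> D x" if "t \<le> x" for x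
  proof (rule nonneg_after_upward_zeros[of t x D D'])
    fix y assume "t \<le> y"
    then have y: "0 < y" using assms by simp
    show "(D has_real_derivative D' y) (at y)" by (rule D'(1)[OF y])
    show "0 < D' y" if "D y = 0" using D'(2)[OF y] y that by (simp add: zero_less_mult_iff)
  qed (use that D_t in auto)
  \<comment> \<open>With \<open>D >= 0\<close> and both terms at most \<open>q\<close>,
    \<open>c x >= 1 + 2 x - 10 q x\<close>, so \<open>1/16\<close> keeps \<open>c\<close>
    positive.\<close>
  have "\<forall>\<^sub>F x in at_top. q x < 1/16"
    using q_at_top by (rule order_tendstoD) simp
  then obtain T0 where T0: "\<And>x. T0 \<le> x \<Longrightarrow> q x < 1/16"
    by (auto simp: eventually_at_top_linorder)
  define T where "T = max T0 t"
  have T: "t \<le> T" "\<And>x. T \<le> x \<Longrightarrow> q x < 1/16" using T0 by (auto simp: T_def)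
  have small: "decay_k x * q x \<le> q x \<and> decay_l x * (q x)\<^sup>2 \<le> q x" if "T \<le> x" for x
  proof -
    have x: "0 < x" using that T(1) assms by simp
    have "decay_k x * q x \<le> 1 * q x"
      using decay_k_bounds[OF x] q_pos[OF x] by (intro mult_right_mono) auto
    moreover have "decay_l x * (q x)\<^sup>2 \<le> 1 * (q x)\<^sup>2"
      using decay_l_bounds[OF x] by (intro mult_right_mono) auto
    moreover have "(q x)\<^sup>2 \<le> q x"
      using T(2)[OF that] q_pos[OF x] by (simp add: power2_eq_square mult_left_le)
    ultimately show ?thesis by simp
  qed
  have D'_pos: "0 < D' x" if "T \<le> x" for x
  proof -
    have x: "0 < x" using that T(1) assms by simp
    have "0 \<le> c x"
      using small[OF that] T(2)[OF that] D_nonneg[OF order_trans[OF T(1) that]] x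
      unfolding c_def D_def by linarith
    then have "0 \<le> D x * c x" using D_nonneg[of x] T(1) that by simp
    then have "0 < x * D' x" using D'(2)[OF x] by linarith
    then show ?thesis using x by (simp add: zero_less_mult_iff)
  qed
  have inc: "D x < D y" if "T \<le> x" "x < y" for x y
  proof (rule DERIV_pos_imp_increasing[OF that(2)])
    fix z assume "x \<le> z" "z \<le> y"
    then show "\<exists>d. (D has_real_derivative d) (at z) \<and> 0 < d"
      using D'(1)[of z] D'_pos[of z] that T(1) assms by auto
  qed
  define d where "d = D (T + 1)"
  have d: "0 < d" using inc[of T "T + 1"] D_nonneg[OF T(1)] by (simp add: d_def)
  have "\<forall>\<^sub>F x in at_top. q x < d / 2"
    using q_at_top d by (intro order_tendstoD) auto
  then obtain N where N: "\<And>x. N \<le> x \<Longrightarrow> q x < d / 2"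
    by (auto simp: eventually_at_top_linorder)
  define x where "x = max N (T + 2)"
  have x: "N \<le> x" "T + 2 \<le> x" by (auto simp: x_def)
  have "d < D x" using inc[of "T + 1" x] x by (simp add: d_def)
  moreover have "D x \<le> 2 * q x"
    using small[of x] e_less[of x] x T(1) assms unfolding D_def by simp
  ultimately show False using N[OF x(1)] by simp
qed

section \<open>The range \<open>0 < t <= 1/5\<close>\<close>

lemma q_le_near_0:
  assumes t: "0 < t" "t \<le> 1/5"
  shows "q t \<le> 2/3"
proof (rule ccontr)
  assume "\<not> q t \<le> 2/3"
  then have q: "2/3 < q t" by simp
  have t2: "t\<^sup>2 \<le> 1/25"
    using power_mono[of t "1/5" 2] t by (simp add: power2_eq_square)
  \<comment> \<open>For such small \<open>e\<close> the upper polynomial increases with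
    \<open>\<tau>\<close>, so the case \<open>\<tau> = 1/25\<close> is decisive.\<close>
  have "61/250 \<le> e t"
  proof (rule ccontr)
    assume "\<not> ?thesis"
    then have e: "0 < e t" "e t < 61/250" using e_pos[OF t(1)] by auto
    have "(e t)\<^sup>2 \<le> 1" using e by (simp add: power_le_one)
    then have "0 \<le> (1/25 - t\<^sup>2) * (1 - 2/5 * e t - 7/50 * (e t)\<^sup>2)"
      using t2 e by (intro mult_nonneg_nonneg) auto
    moreover have "upper_poly (e t) (1/25) - upper_poly (e t) (t\<^sup>2)
        = (1/25 - t\<^sup>2) * (1 - 2/5 * e t - 7/50 * (e t)\<^sup>2)"
      unfolding upper_poly_def by algebra
    moreover have "upper_poly (e t) (1/25) \<le> 2/3"
      using upper_poly_small[of "e t"] e by simp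
    ultimately show False
      using q_le_upper_poly[of t] t q by linarith
  qed
  \<comment> \<open>A constant barrier carries the bound from the arbitrary \<open>t\<close> to the
    fixed time \<open>1/5\<close>.\<close>
  then have "61/250 \<le> e (1/5)"
  proof (intro e_barrier[of t "1/5" "\<lambda>_. 61/250" "\<lambda>_. 0"])
    fix x :: real assume x: "t \<le> x" "x \<le> 1/5"
    have "x\<^sup>2 \<le> 1/25"
      using power_mono[of x "1/5" 2] x t by (simp add: power2_eq_square)
    then show "x * 0 < lower_poly (61/250) (x\<^sup>2) - x\<^sup>2 - 61/250 + (61/250)\<^sup>2"
      unfolding lower_poly_def by (simp add: power2_eq_square power_numeral_reduce)
  qed (use t in auto)
  \<comment> \<open>Each quadratic starts no higher than its predecessor ends, so the barriers chain
    from \<open>61/250\<close> at \<open>1/5\<close> to \<open>7/5\<close> at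
    \<open>7/10\<close>.\<close>
  define p1 p2 p3 p4 :: "real \<Rightarrow> real" where
    "p1 = (\<lambda>t. 61/250 + 217/100*(t - 1/5) + 12/5*(t - 1/5)\<^sup>2)" and
    "p2 = (\<lambda>t. 179/500 + 241/100*(t - 1/4) + 4/5*(t - 1/4)\<^sup>2)" and
    "p3 = (\<lambda>t. 607/1000 + 64/25*(t - 7/20) - 17/25*(t - 7/20)\<^sup>2)" and
    "p4 = (\<lambda>t. 39/40 + 59/25*(t - 1/2) - 117/100*(t - 1/2)\<^sup>2)"
  have "p1 (1/4) \<le> e (1/4)"
  proof (rule e_barrier[of "1/5" _ _ "\<lambda>t. 217/100 + 24/5*(t - 1/5)"])
    show "p1 (1/5) \<le> e (1/5)" using \<open>61/250 \<le> e (1/5)\<close> by (simp add: p1_def)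
    fix x :: real assume x: "1/5 \<le> x" "x \<le> 1/4"
    show "(p1 has_real_derivative 217/100 + 24/5*(x - 1/5)) (at x)"
      unfolding p1_def by (auto intro!: derivative_eq_intros)
    have "1/1000 \<le> lower_poly (p1 x) (x\<^sup>2) - x\<^sup>2 - p1 x + (p1 x)\<^sup>2 - x * (217/100 + 24/5*(x - 1/5))"
      by (rule barrier_slope_1[OF x]) (simp add: p1_def)
    then show "x * (217/100 + 24/5*(x - 1/5)) < lower_poly (p1 x) (x\<^sup>2) - x\<^sup>2 - p1 x + (p1 x)\<^sup>2"
      by linarith
  qed auto
  have "p2 (7/20) \<le> e (7/20)"
  proof (rule e_barrier[of "1/4" _ _ "\<lambda>t. 241/100 + 8/5*(t - 1/4)"])
    show "p2 (1/4) \<le> e (1/4)" using \<open>p1 (1/4) \<le> e (1/4)\<close> by (simp add: p1_def p2_def power2_eq_square)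
    fix x :: real assume x: "1/4 \<le> x" "x \<le> 7/20"
    show "(p2 has_real_derivative 241/100 + 8/5*(x - 1/4)) (at x)"
      unfolding p2_def by (auto intro!: derivative_eq_intros)
    have "1/1000 \<le> lower_poly (p2 x) (x\<^sup>2) - x\<^sup>2 - p2 x + (p2 x)\<^sup>2 - x * (241/100 + 8/5*(x - 1/4))"
      by (rule barrier_slope_2[OF x]) (simp add: p2_def)
    then show "x * (241/100 + 8/5*(x - 1/4)) < lower_poly (p2 x) (x\<^sup>2) - x\<^sup>2 - p2 x + (p2 x)\<^sup>2"
      by linarith
  qed auto
  have "p3 (1/2) \<le> e (1/2)"
  proof (rule e_barrier[of "7/20" _ _ "\<lambda>t. 64/25 - 34/25*(t - 7/20)"])
    show "p3 (7/20) \<le> e (7/20)" using \<open>p2 (7/20) \<le> e (7/20)\<close> by (simp add: p2_def p3_def power2_eq_square)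
    fix x :: real assume x: "7/20 \<le> x" "x \<le> 1/2"
    show "(p3 has_real_derivative 64/25 - 34/25*(x - 7/20)) (at x)"
      unfolding p3_def by (auto intro!: derivative_eq_intros)
    have "1/1000 \<le> lower_poly (p3 x) (x\<^sup>2) - x\<^sup>2 - p3 x + (p3 x)\<^sup>2 - x * (64/25 - 34/25*(x - 7/20))"
      by (rule barrier_slope_3[OF x]) (simp add: p3_def)
    then show "x * (64/25 - 34/25*(x - 7/20)) < lower_poly (p3 x) (x\<^sup>2) - x\<^sup>2 - p3 x + (p3 x)\<^sup>2"
      by linarith
  qed auto
  have "p4 (7/10) \<le> e (7/10)"
  proof (rule e_barrier[of "1/2" _ _ "\<lambda>t. 59/25 - 117/50*(t - 1/2)"])
    show "p4 (1/2) \<le> e (1/2)" using \<open>p3 (1/2) \<le> e (1/2)\<close> by (simp add: p3_def p4_def power2_eq_square)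
    fix x :: real assume x: "1/2 \<le> x" "x \<le> 7/10"
    show "(p4 has_real_derivative 59/25 - 117/50*(x - 1/2)) (at x)"
      unfolding p4_def by (auto intro!: derivative_eq_intros)
    have "1/1000 \<le> lower_poly (p4 x) (x\<^sup>2) - x\<^sup>2 - p4 x + (p4 x)\<^sup>2 - x * (59/25 - 117/50*(x - 1/2))"
      by (rule barrier_slope_4[OF x]) (simp add: p4_def)
    then show "x * (59/25 - 117/50*(x - 1/2)) < lower_poly (p4 x) (x\<^sup>2) - x\<^sup>2 - p4 x + (p4 x)\<^sup>2"
      by linarith
  qed auto
  then have e: "7/5 \<le> e (7/10)" by (simp add: p4_def power2_eq_square)
  \<comment> \<open>With \<open>g\<close> below \<open>q (7/10)\<close>, the decay relation demands
    \<open>k g + l g^2 <= 3/10 - y\<close>. This fails at \<open>y = 0\<close>, where the quadratic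
    term tips the balance, and the right side falls faster as \<open>y\<close> grows.\<close>
  define y where "y = e (7/10) - 7/5"
  define g where "g = 629/500 - 28/25 * y"
  have y: "0 \<le> y" "y < 3/10" using e e_less[of "7/10"] by (auto simp: y_def)
  have g: "0 < g" using y by (simp add: g_def)
  have "g \<le> q (7/10)"
    using lower_poly_end[of "e (7/10)"] lower_poly_le_q[of "7/10"] y
    by (simp add: y_def g_def power2_eq_square)
  have k: "2219/10000 \<le> decay_k (7/10)"
    by (simp add: decay_k_def power2_eq_square)
  have l: "18/1000 \<le> decay_l (7/10)"
    by (simp add: decay_l_def decay_k_def power2_eq_square)
  have "2219/10000 * g \<le> decay_k (7/10) * q (7/10)"
    using k g \<open>g \<le> q (7/10)\<close> by (intro mult_mono) auto
  moreover have "18/1000 * g\<^sup>2 \<le> decay_l (7/10) * (q (7/10))\<^sup>2"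
    using l g \<open>g \<le> q (7/10)\<close> by (intro mult_mono power_mono) auto
  moreover have "g\<^sup>2 = 395641/250000 - 8806/3125 * y + 784/625 * y\<^sup>2"
    unfolding g_def by algebra
  moreover have "0 \<le> y\<^sup>2" by simp
  moreover have "decay_k (7/10) * q (7/10) + decay_l (7/10) * (q (7/10))\<^sup>2 \<le> 3/10 - y"
    using decay_bound[of "7/10"] by (simp add: y_def)
  moreover have "2219/10000 * g = 2219/10000 * (629/500) - 2219/10000 * (28/25) * y"
    by (simp add: g_def algebra_simps)
  ultimately show False using y(1) by linarith
qed

section \<open>The range \<open>t >= 3/2\<close>\<close>

lemma u_exp_bound:
  assumes "0 < a" "a \<le> b" and slope: "\<And>x. a \<le> x \<Longrightarrow> x \<le> b \<Longrightarrow> v x \<le> - r * u x"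
  shows "u b * exp (r * (b - a)) \<le> u a"
proof -
  have "u b * exp (r * b) \<le> u a * exp (r * a)"
  proof (rule DERIV_nonpos_imp_nonincreasing[OF assms(2)])
    fix x assume x: "a \<le> x" "x \<le> b"
    have "((\<lambda>x. u x * exp (r * x)) has_real_derivative (v x + r * u x) * exp (r * x)) (at x)"
      using x assms(1) by (auto intro!: derivative_eq_intros DERIV_u simp: algebra_simps)
    moreover have "(v x + r * u x) * exp (r * x) \<le> 0"
      using slope[OF x] by (intro mult_nonpos_nonneg) auto
    ultimately show "\<exists>y. ((\<lambda>x. u x * exp (r * x)) has_real_derivative y) (at x) \<and> y \<le> 0"
      by blast
  qed
  then have "u b * exp (r * b) / exp (r * a) \<le> u a"
    by (simp add: field_simps)
  then show ?thesis by (simp add: exp_diff right_diff_distrib)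
qed

lemma q_le_far:
  assumes t: "3/2 \<le> t"
  shows "q t \<le> 2/3"
proof (rule ccontr)
  assume "\<not> q t \<le> 2/3"
  then have qt: "2/3 < q t" by simp
  have q_u: "q x = (u x)\<^sup>2" for x by (simp add: q_def u_def)
  have e1: "0 < e 1" "e 1 < 2" using e_pos[of 1] e_less[of 1] by auto
  have q1: "q 1 \<le> upper_poly (e 1) 1" using q_le_upper_poly[of 1] by simp
  have "(Q 1)\<^sup>2 < 2" using q1 upper_poly_at_1[of "e 1"] e1 by (simp add: q_def)
  have Q_mono: "Q y \<le> Q x" if "0 < x" "x \<le> y" for x y
  proof (rule DERIV_nonpos_imp_nonincreasing[OF that(2)])
    fix z assume "x \<le> z" "z \<le> y"
    then have "0 < z" using that by simp
    then show "\<exists>d. (Q has_real_derivative d) (at z) \<and> d \<le> 0"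
      using DERIV_Q Q'_neg by (meson less_imp_le)
  qed
  \<comment> \<open>A zero of \<open>v\<close> would need \<open>Q^2 > 2\<close> by the energy
    inequality, and \<open>v\<close> is nonpositive far out.\<close>
  have v_neg: "v x < 0" if x: "1 \<le> x" for x
  proof -
    have v_nz: "v y \<noteq> 0" if y: "1 \<le> y" for y
    proof
      assume "v y = 0"
      then have "(u y)\<^sup>2 * (1 - (Q y)\<^sup>2 / 2) < 0" using energy_u_pos[of y] y by simp
      then have "2 < (Q y)\<^sup>2" by (simp add: mult_less_0_iff)
      moreover have "(Q y)\<^sup>2 \<le> (Q 1)\<^sup>2"
        using Q_mono[of 1 y] Q_pos[of y] y by (intro power_mono) auto
      ultimately show False using \<open>(Q 1)\<^sup>2 < 2\<close> by simp
    qed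
    obtain T where T: "\<And>y. T \<le> y \<Longrightarrow> v y \<le> 0" using convex_at_top by blast
    show ?thesis
    proof (rule ccontr)
      assume "\<not> v x < 0"
      moreover have "isCont v y" if "x \<le> y" for y
        using DERIV_v[of y] that x by (intro DERIV_isCont) auto
      ultimately have "\<exists>y\<ge>x. y \<le> max x T \<and> v y = 0"
        using T[of "max x T"] by (intro IVT2) auto
      then show False using v_nz x by auto
    qed
  qed
  have u_anti: "u y \<le> u x" if "1 \<le> x" "x \<le> y" for x y
  proof (rule DERIV_nonpos_imp_nonincreasing[OF that(2)])
    fix z assume "x \<le> z" "z \<le> y"
    then show "\<exists>d. (u has_real_derivative d) (at z) \<and> d \<le> 0"
      using DERIV_u[of z] v_neg[of z] that by (intro exI[of _ "v z"]) auto
  qed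
  \<comment> \<open>\<open>2041/2500\<close> is the square root of \<open>2/3\<close> rounded
    down.\<close>
  have u32: "2041/2500 < u (3/2)"
  proof -
    have "(2041/2500)\<^sup>2 < (u t)\<^sup>2" using qt by (simp add: q_u power2_eq_square)
    then have "2041/2500 < u t" using u_pos[of t] t by (intro power2_less_imp_less[of "2041/2500"]) auto
    then show ?thesis using u_anti[of "3/2" t] t by simp
  qed
  \<comment> \<open>Otherwise \<open>Q x <= (113/100) / a\<close> for \<open>x >= a\<close>, and the
    energy inequality bounds the decay rate of \<open>u\<close> from below: by \<open>3/5\<close>
    from \<open>1\<close> on and by \<open>19/25\<close> from \<open>5/4\<close> on. Going back from
    \<open>3/2\<close> to \<open>1\<close>, \<open>u\<close> then gains the factor
    \<open>exp (17/50)\<close>, too much for \<open>u 1 < 113/100\<close>.\<close>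
  have "113/100 \<le> u 1"
  proof (rule ccontr)
    assume "\<not> ?thesis"
    then have u1: "u 1 < 113/100" by simp
    have slope: "v x \<le> - r * u x" if "a \<le> x" "1 \<le> a" "0 \<le> r" "(113/100)\<^sup>2 / (2 * a\<^sup>2) \<le> 1 - r\<^sup>2"
      for x a r :: real
    proof -
      have x: "0 < x" using that by simp
      have "Q x \<le> (113/100) / a"
      proof -
        have "x * Q x \<le> 113/100" using u_anti[of 1 x] u1 that by (simp add: u_def)
        moreover have "a * Q x \<le> x * Q x" using that Q_pos[of x] by (intro mult_right_mono) auto
        ultimately show ?thesis using that by (simp add: field_simps)
      qed
      then have "(Q x)\<^sup>2 \<le> ((113/100) / a)\<^sup>2" using Q_pos[of x] x by (intro power_mono) auto
      then have "r\<^sup>2 \<le> 1 - (Q x)\<^sup>2 / 2" using that(4) by (simp add: power_divide)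
      then have "(u x)\<^sup>2 * r\<^sup>2 \<le> (u x)\<^sup>2 * (1 - (Q x)\<^sup>2 / 2)" by (intro mult_left_mono) auto
      then have "(r * u x)\<^sup>2 < (- v x)\<^sup>2"
        using energy_u_pos[OF x] by (simp add: power_mult_distrib mult.commute)
      moreover have "0 \<le> - v x" using v_neg[of x] that(1,2) by simp
      ultimately have "r * u x < - v x" by (rule power2_less_imp_less)
      then show ?thesis by simp
    qed
    have "u (5/4) * exp (3/5 * (5/4 - 1)) \<le> u 1"
      by (rule u_exp_bound, simp, simp, rule slope[of 1]) (auto simp: power2_eq_square)
    moreover have "u (3/2) * exp (19/25 * (3/2 - 5/4)) \<le> u (5/4)"
      by (rule u_exp_bound, simp, simp, rule slope[of "5/4"]) (auto simp: power2_eq_square)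
    ultimately have "u (3/2) * exp (19/25 * (3/2 - 5/4)) * exp (3/5 * (5/4 - 1)) \<le> u 1"
      by (smt (verit) exp_gt_zero mult_right_mono)
    then have "u (3/2) * exp (17/50) \<le> u 1"
      by (simp add: mult.assoc flip: exp_add)
    moreover have "1 + 17/50 + (17/50)\<^sup>2 / 2 \<le> exp (17/50 :: real)"
      by (rule exp_lower_Taylor_quadratic) simp
    moreover have "2041/2500 * (1 + 17/50 + (17/50)\<^sup>2 / 2) \<le> u (3/2) * exp (17/50)"
      using u32 calculation(2) by (intro mult_mono) auto
    ultimately show False using u1 by (simp add: power2_eq_square)
  qed
  then have q1_ge: "12769/10000 \<le> q 1"
    using power_mono[of "113/100" "u 1" 2] by (simp add: q_u power2_eq_square)
  have v1: "v 1 = Q 1 * (1 - e 1)" using Q_pos[of 1] by (simp add: v_def e_def field_simps)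
  have "1 < e 1" using v_neg[of 1] Q_pos[of 1] unfolding v1 by (simp add: mult_less_0_iff)
  \<comment> \<open>The energy inequality at \<open>t = 1\<close>, where \<open>u = Q\<close> and
    \<open>v = Q (1 - e)\<close>.\<close>
  have "(Q 1)\<^sup>2 * (1 - q 1 / 2) < (Q 1)\<^sup>2 * (1 - e 1)\<^sup>2"
    using energy_u_pos[of 1] unfolding v1 by (simp add: u_def q_def power_mult_distrib)
  then have "1 - q 1 / 2 < (1 - e 1)\<^sup>2" using Q_pos[of 1] by simp
  then have "2 * e 1 * (2 - e 1) < q 1" by (simp add: power2_eq_square algebra_simps)
  \<comment> \<open>For \<open>e 1 > 8/5\<close> the contradiction is
    \<open>127/100 < 12769/10000\<close>.\<close>
  then show False
    using q1 q1_ge upper_poly_at_1_mid[of "e 1"] upper_poly_at_1_large[of "e 1"] \<open>1 < e 1\<close> e1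
    by (cases "e 1 \<le> 8/5") auto
qed

end

theorem lemma4p2:
  fixes Q :: "real \<Rightarrow> real" and t :: real
  assumes "ground_state_profile Q"
    and "(0 < t \<and> t \<le> 0.2) \<or> t \<ge> 1.5"
  shows "2 / t^2 \<ge> 3 * (Q t)^2"
proof -
  obtain Q' Q'' where Q: "continuous_on {0..} Q" "\<forall>t\<ge>0. Q t > 0"
    "\<forall>t>0. (Q has_real_derivative Q' t) (at t)"
    "\<forall>t>0. (Q' has_real_derivative Q'' t) (at t)"
    "\<forall>t>0. - Q'' t - (2 / t) * Q' t + Q t - (Q t)^3 = 0"
    "(Q' \<longlongrightarrow> 0) (at_right 0)" "(Q \<longlongrightarrow> 0) at_top"
    using assms(1) unfolding ground_state_profile_def by (elim conjE exE) (rule that)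
  interpret ground_state Q Q'
  proof
    fix t :: real assume t: "0 < t"
    have "- Q'' t - (2 / t) * Q' t + Q t - (Q t)^3 = 0" using Q(5) t by blast
    then have "Q'' t = Q t - Q t ^ 3 - 2 / t * Q' t" by linarith
    moreover have "(Q' has_real_derivative Q'' t) (at t)" using Q(4) t by blast
    ultimately show "(Q' has_real_derivative Q t - Q t ^ 3 - 2 / t * Q' t) (at t)" by simp
    show "(Q has_real_derivative Q' t) (at t)" using Q(3) t by blast
  next
    show "0 < Q t" if "0 \<le> t" for t using Q(2) that by blast
  qed (fact Q)+
  have t: "0 < t" using assms(2) by auto
  have "q t \<le> 2/3" using assms(2) q_le_near_0[of t] q_le_far[of t] by auto
  then show ?thesis using t by (simp add: q_def power_mult_distrib field_simps)
qed

end
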